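(* Let $S$ be a unitarily one-parameter poset with elements $g_1,\dots,g_{k-1},g_{k,1},g_{k,2},g_{k+1},\dots,g_m$, where $1\le k\le m$, ordered so that $g_1<\dots<g_{k-1}$, $g_{k-1}<g_{k,i}<g_{k+1}$ for $i=1,2$, $g_{k+1}<\dots<g_m$, and $g_{k,1},g_{k,2}$ are incomparable. Let $(P_g)_{g\in S}$ be a Hilbert representation of $S$, write $P_j=P_{g_j}$ for $j\ne k$ and $P_{k,i}=P_{g_{k,i}}$ for $i=1,2$, let $\alpha_j>0$ ($j\neq k$), $\alpha_{k,1},\alpha_{k,2}>0$, and put $$A=\sum_{j\ne k}\alpha_jP_j+\alpha_{k,1}P_{k,1}+\alpha_{k,2}P_{k,2}.$$ Let $$\Sigma=\alpha_{k,1}+\alpha_{k,2}+2\sum_{j>k}\alpha_j,$$ and let $\Delta_d$ be the finite set consisting of the numbers $0$; $\ \sum_{j\ge i}\alpha_j$ for $k+1\le i\le m$; $\ \alpha_{k,1}+\sum_{j>k}\alpha_j$; $\ \alpha_{k,2}+\sum_{j>k}\alpha_j$; $\ \alpha_{k,1}+\alpha_{k,2}+\sum_{j>k}\alpha_j$; and $\ \sum_{i\le j\le k-1}\alpha_j+\alpha_{k,1}+\alpha_{k,2}+\sum_{j>k}\alpha_j$ for $1\le i\le k-1$. Let $$\Delta_c^{\pm}=\Bigl\{\tfrac{\Sigma\pm\lambda}{2}\ :\ |\alpha_{k,1}-\alpha_{k,2}|<\lambda<\alpha_{k,1}+\alpha_{k,2}\Bigr\}.$$ Then $$\sigma(A)\subset\Delta:=\Delta_d\cup\Delta_c^+\cup\Delta_c^-.$$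 Moreover, the parts of the spectrum of $A$ in $\Delta_c^+$ and in $\Delta_c^-$ have the same type and multiplicity (corresponding to each other under the reflection $x\mapsto\Sigma-x$). In particular, for $|\alpha_{k,1}-\alpha_{k,2}|<\lambda<\alpha_{k,1}+\alpha_{k,2}$, the number $(\Sigma+\lambda)/2$ is an eigenvalue of $A$ if and only if $(\Sigma-\lambda)/2$ is an eigenvalue of $A$ of the same multiplicity.
   Context: A finite poset $S$ is called unitarily one-parameter if it can be written as a disjoint union $S=S_1\cup\dots\cup S_m$ of blocks such that every element of $S_i$ is strictly less than every element of $S_j$ for $i<j$, exactly one block $S_k$ consists of two incomparable elements, and every other block consists of a single element. If $k=1$ (respectively $k=m$), conditions and sums involving indices $<k$ (respectively $>k$) are vacuous or empty. A (Hilbert) representation of a finite poset $S$ is a family of orthogonal projections $P_g$, $g\in S$, in a complex Hilbert space $H$ such that $P_gP_h=P_g$ whenever $g<h$. $\sigma(A)$ denotes the spectrum of the bounded self-adjoint operator $A$. Saying that the parts of the spectrum in $\Delta_c^+$ and $\Delta_c^-$ have the same type and multiplicity means that, with $E$ the spectral measure of $A$, the restriction of $A$ to $E(\Delta_c^+)H$ is unitarily equivalent to the restriction of $\Sigma I-A$ to $E(\Delta_c^-)H$. *)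

theory Defs
  imports "HOL-Analysis.Analysis" "HOL-Library.Equipollence"
begin

text \<open>The complex structure sits on top of the library's real one: the norm and the topology are
  those of class \<open>real_inner\<close>, whose inner product is the real part of the complex one.
  The complex inner product is conjugate-linear in its first argument.\<close>

class complex_hilbert_space = real_inner + complete_space +
  fixes scaleC :: "complex \<Rightarrow> 'a \<Rightarrow> 'a"  (infixr \<open>*\<^sub>C\<close> 75)
    and cinner :: "'a \<Rightarrow> 'a \<Rightarrow> complex"
  assumes scaleC_add_right: "c *\<^sub>C (x + y) = c *\<^sub>C x + c *\<^sub>C y"
    and scaleC_add_left: "(c + d) *\<^sub>C x = c *\<^sub>C x + d *\<^sub>C x"
    and scaleC_scaleC: "c *\<^sub>C (d *\<^sub>C x) = (c * d) *\<^sub>C x"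
    and scaleC_of_real: "complex_of_real r *\<^sub>C x = r *\<^sub>R x"
    and cinner_commute: "cinner x y = cnj (cinner y x)"
    and cinner_add_right: "cinner x (y + z) = cinner x y + cinner x z"
    and cinner_scaleC_right: "cinner x (c *\<^sub>C y) = c * cinner x y"
    and inner_eq_Re_cinner: "inner x y = Re (cinner x y)"

instantiation complex :: complex_hilbert_space
begin

definition "scaleC_complex (c :: complex) (x :: complex) = c * x"
definition "cinner_complex (x :: complex) (y :: complex) = cnj x * y"

instance
  by standard
    (auto simp: scaleC_complex_def cinner_complex_def inner_complex_def algebra_simps
      scaleR_conv_of_real)

end

definition bounded_clinear ::
    "('a::complex_hilbert_space \<Rightarrow> 'b::complex_hilbert_space) \<Rightarrow> bool" where
  "bounded_clinear T \<longleftrightarrow> bounded_linear T \<and> (\<forall>c x. T (c *\<^sub>C x) = c *\<^sub>C T x)"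

definition orthogonal_projection :: "('a::complex_hilbert_space \<Rightarrow> 'a) \<Rightarrow> bool" where
  "orthogonal_projection P \<longleftrightarrow>
     bounded_clinear P \<and> P \<circ> P = P \<and> (\<forall>x y. cinner (P x) y = cinner x (P y))"

definition spectrum :: "('a::complex_hilbert_space \<Rightarrow> 'a) \<Rightarrow> complex set" where
  "spectrum T = {z. \<not> (\<exists>R. bounded_clinear R \<and>
     (\<forall>x. R (T x - z *\<^sub>C x) = x) \<and> (\<forall>x. T (R x) - z *\<^sub>C R x = x))}"

definition eigenspace :: "('a::complex_hilbert_space \<Rightarrow> 'a) \<Rightarrow> complex \<Rightarrow> 'a set" where
  "eigenspace T z = {x. T x = z *\<^sub>C x}"

definition eigenvalue :: "('a::complex_hilbert_space \<Rightarrow> 'a) \<Rightarrow> complex \<Rightarrow> bool" where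
  "eigenvalue T z \<longleftrightarrow> (\<exists>x. x \<noteq> 0 \<and> T x = z *\<^sub>C x)"

text \<open>Intended for closed subspaces \<open>V\<close>, where a complete orthonormal set is an orthonormal basis.\<close>

definition orthonormal_basis :: "'a::complex_hilbert_space set \<Rightarrow> 'a set \<Rightarrow> bool" where
  "orthonormal_basis V B \<longleftrightarrow> B \<subseteq> V \<and>
     (\<forall>b\<in>B. \<forall>c\<in>B. cinner b c = (if b = c then 1 else 0)) \<and>
     (\<forall>x\<in>V. (\<forall>b\<in>B. cinner b x = 0) \<longrightarrow> x = 0)"

text \<open>Dimensions are compared as cardinals, so that infinite multiplicities are distinguished.\<close>

definition same_dimension ::
    "'a::complex_hilbert_space set \<Rightarrow> 'b::complex_hilbert_space set \<Rightarrow> bool" where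
  "same_dimension V W \<longleftrightarrow> (\<exists>B C. orthonormal_basis V B \<and> orthonormal_basis W C \<and> B \<approx> C)"

definition same_multiplicity ::
    "('a::complex_hilbert_space \<Rightarrow> 'a) \<Rightarrow> complex \<Rightarrow> complex \<Rightarrow> bool" where
  "same_multiplicity T z w \<longleftrightarrow> same_dimension (eigenspace T z) (eigenspace T w)"

definition unitarily_equivalent_on ::
    "'a::complex_hilbert_space set \<Rightarrow> ('a \<Rightarrow> 'a) \<Rightarrow>
     'b::complex_hilbert_space set \<Rightarrow> ('b \<Rightarrow> 'b) \<Rightarrow> bool" where
  "unitarily_equivalent_on V T W S \<longleftrightarrow> T ` V \<subseteq> V \<and> S ` W \<subseteq> W \<and>
     (\<exists>U. bij_betw U V W \<and>
          (\<forall>x\<in>V. \<forall>y\<in>V. U (x + y) = U x + U y) \<and>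
          (\<forall>c. \<forall>x\<in>V. U (c *\<^sub>C x) = c *\<^sub>C U x) \<and>
          (\<forall>x\<in>V. \<forall>y\<in>V. cinner (U x) (U y) = cinner x y) \<and>
          (\<forall>x\<in>V. U (T x) = S (U x)))"

definition projection_valued_measure ::
    "(real set \<Rightarrow> 'a::complex_hilbert_space \<Rightarrow> 'a) \<Rightarrow> bool" where
  "projection_valued_measure E \<longleftrightarrow>
     (\<forall>B\<in>sets borel. orthogonal_projection (E B)) \<and>
     E {} = (\<lambda>x. 0) \<and> E UNIV = id \<and>
     (\<forall>B\<in>sets borel. \<forall>C\<in>sets borel. E (B \<inter> C) = E B \<circ> E C) \<and>
     (\<forall>F :: nat \<Rightarrow> real set. range F \<subseteq> sets borel \<and> disjoint_family F \<longrightarrow>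
        (\<forall>x. (\<lambda>n. E (F n) x) sums E (\<Union>n. F n) x))"

definition scalar_spectral_measure ::
    "(real set \<Rightarrow> 'a::complex_hilbert_space \<Rightarrow> 'a) \<Rightarrow> 'a \<Rightarrow> real measure" where
  "scalar_spectral_measure E x =
     measure_of UNIV (sets borel) (\<lambda>B. ennreal (Re (cinner x (E B x))))"

text \<open>The spectral measure of a bounded self-adjoint operator \<open>T\<close>, that is \<open>T = \<integral> t dE(t)\<close>. The
  integral is taken weakly; by polarization the quadratic form determines \<open>T\<close>. Bounded support
  makes \<open>t\<close> integrable, so that the Bochner integral never takes its default value \<open>0\<close>.\<close>

definition spectral_measure_of ::
    "('a::complex_hilbert_space \<Rightarrow> 'a) \<Rightarrow> (real set \<Rightarrow> 'a \<Rightarrow> 'a) \<Rightarrow> bool" where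
  "spectral_measure_of T E \<longleftrightarrow> projection_valued_measure E \<and>
     (\<exists>r. E {-r..r} = id) \<and>
     (\<forall>x. cinner x (T x) = complex_of_real (\<integral>t. t \<partial>scalar_spectral_measure E x))"

definition unitarily_one_parameter :: "'s::order set \<Rightarrow> bool" where
  "unitarily_one_parameter S \<longleftrightarrow> finite S \<and>
     (\<exists>m k (B :: nat \<Rightarrow> 's set). k \<in> {1..m} \<and>
        S = (\<Union>i\<in>{1..m}. B i) \<and> disjoint_family_on B {1..m} \<and>
        (\<forall>i\<in>{1..m}. \<forall>j\<in>{1..m}. i < j \<longrightarrow> (\<forall>x\<in>B i. \<forall>y\<in>B j. x < y)) \<and>
        (\<exists>x y. B k = {x, y} \<and> \<not> x \<le> y \<and> \<not> y \<le> x) \<and>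
        (\<forall>i\<in>{1..m} - {k}. \<exists>x. B i = {x}))"

text \<open>The elements of \<open>S\<close> are \<open>g j\<close> for \<open>j \<noteq> k\<close> in \<open>{1..m}\<close>, together with the incomparable pair
  \<open>h\<^sub>1\<close>, \<open>h\<^sub>2\<close> at level \<open>k\<close>; the value \<open>g k\<close> is irrelevant.\<close>

definition one_parameter_enumeration ::
    "'s::order set \<Rightarrow> nat \<Rightarrow> nat \<Rightarrow> (nat \<Rightarrow> 's) \<Rightarrow> 's \<Rightarrow> 's \<Rightarrow> bool" where
  "one_parameter_enumeration S m k g h\<^sub>1 h\<^sub>2 \<longleftrightarrow>
     1 \<le> k \<and> k \<le> m \<and>
     S = g ` ({1..m} - {k}) \<union> {h\<^sub>1, h\<^sub>2} \<and>
     (\<forall>i j. 1 \<le> i \<and> i < j \<and> j < k \<longrightarrow> g i < g j) \<and>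
     (1 < k \<longrightarrow> g (k - 1) < h\<^sub>1 \<and> g (k - 1) < h\<^sub>2) \<and>
     (k < m \<longrightarrow> h\<^sub>1 < g (k + 1) \<and> h\<^sub>2 < g (k + 1)) \<and>
     (\<forall>i j. k < i \<and> i < j \<and> j \<le> m \<longrightarrow> g i < g j) \<and>
     \<not> h\<^sub>1 \<le> h\<^sub>2 \<and> \<not> h\<^sub>2 \<le> h\<^sub>1"

definition hilbert_representation ::
    "'s::order set \<Rightarrow> ('s \<Rightarrow> 'a::complex_hilbert_space \<Rightarrow> 'a) \<Rightarrow> bool" where
  "hilbert_representation S P \<longleftrightarrow>
     (\<forall>g\<in>S. orthogonal_projection (P g)) \<and>
     (\<forall>g\<in>S. \<forall>h\<in>S. g < h \<longrightarrow> P g \<circ> P h = P g)"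

text \<open>Here \<open>a\<^sub>1\<close> and \<open>a\<^sub>2\<close> are the weights of the two incomparable elements at
  level \<open>k\<close>, and the value \<open>\<alpha> k\<close> is not used.\<close>

definition Delta_d :: "nat \<Rightarrow> nat \<Rightarrow> (nat \<Rightarrow> real) \<Rightarrow> real \<Rightarrow> real \<Rightarrow> real set" where
  "Delta_d m k \<alpha> a\<^sub>1 a\<^sub>2 =
     {0} \<union>
     {\<Sum>j=i..m. \<alpha> j | i. k + 1 \<le> i \<and> i \<le> m} \<union>
     {a\<^sub>1 + (\<Sum>j=k+1..m. \<alpha> j), a\<^sub>2 + (\<Sum>j=k+1..m. \<alpha> j), a\<^sub>1 + a\<^sub>2 + (\<Sum>j=k+1..m. \<alpha> j)} \<union>
     {(\<Sum>j=i..k-1. \<alpha> j) + a\<^sub>1 + a\<^sub>2 + (\<Sum>j=k+1..m. \<alpha> j) | i. 1 \<le> i \<and> i \<le> k - 1}"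

text \<open>The argument \<open>s\<close> is \<open>a\<^sub>1 + a\<^sub>2 + 2 * (\<Sum>j=k+1..m. \<alpha> j)\<close>:
  the two sets are exchanged by \<open>x \<mapsto> s - x\<close>.\<close>

definition Delta_c_plus :: "real \<Rightarrow> real \<Rightarrow> real \<Rightarrow> real set" where
  "Delta_c_plus s a\<^sub>1 a\<^sub>2 = {(s + l) / 2 | l. \<bar>a\<^sub>1 - a\<^sub>2\<bar> < l \<and> l < a\<^sub>1 + a\<^sub>2}"

definition Delta_c_minus :: "real \<Rightarrow> real \<Rightarrow> real \<Rightarrow> real set" where
  "Delta_c_minus s a\<^sub>1 a\<^sub>2 = {(s - l) / 2 | l. \<bar>a\<^sub>1 - a\<^sub>2\<bar> < l \<and> l < a\<^sub>1 + a\<^sub>2}"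

end

theory Submission
  imports Defs
begin

text \<open>
Let \<open>P\<^sub>1\<close>, \<open>P\<^sub>2\<close> be the projections of the incomparable pair and \<open>c\<close> the sum of the weights above it.
Those of the other elements commute with all the projections, so the space splits into the blocks
between consecutive members of the chain. On a block above or below the pair \<open>A\<close> is a scalar, and
these scalars are in the discrete set. On the block that contains the pair \<open>A = c + a\<^sub>1 P\<^sub>1 + a\<^sub>2 P\<^sub>2\<close>.
With the reflections \<open>R\<^sub>i = 2 P\<^sub>i - 1\<close> this reads \<open>D = a\<^sub>1 R\<^sub>1 + a\<^sub>2 R\<^sub>2\<close> for \<open>D = 2 A - s\<close>, and
\<open>D\<^sup>2 = a\<^sub>1\<^sup>2 + a\<^sub>2\<^sup>2 + a\<^sub>1 a\<^sub>2 T\<close> where \<open>T = R\<^sub>1 R\<^sub>2 + R\<^sub>2 R\<^sub>1\<close> has norm at most \<open>2\<close>. Hence \<open>D - w\<close> is bounded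
below unless \<open>w\<close> is between \<open>\<bar>a\<^sub>1 - a\<^sub>2\<bar>\<close> and \<open>a\<^sub>1 + a\<^sub>2\<close> in absolute value, which locates the spectrum
(\<open>controlled_middle\<close>, \<open>spectrum_A\<close>).

The symmetry comes from half the commutator of the pair, \<open>K\<close>. It satisfies \<open>K A = (s - A) K\<close> on the
whole space (\<open>K_reflects\<close>), it is skew, and \<open>64 K\<^sup>2 = T\<^sup>2 - 4\<close>. On the middle block the last operator is a
polynomial in \<open>D\<close> that vanishes only at the end points of the two intervals of the continuous part
(\<open>KK_factorization\<close>). So \<open>K\<close> maps one part of the spectrum to the other, injectively and with dense
range, and the unitary factor of its polar decomposition is the required equivalence. On an
eigenspace \<open>K\<^sup>2\<close> is a negative scalar, and \<open>K\<close> itself is a multiple of a unitary map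
(\<open>eigenvectors_reflect\<close>).

For the spectral subspaces one needs to know that \<open>K\<close> carries the range of \<open>E {a..b}\<close> to that of
\<open>E {s - b..s - a}\<close>. The range of \<open>E {a..b}\<close> is characterized by the growth of the powers of
\<open>A - (a + b) / 2\<close> on it (\<open>in_interval_range_iff\<close>), and an operator that intertwines \<open>A\<close> with \<open>s - A\<close>
preserves this growth. The absolute value of \<open>K\<close> is obtained from an iteration for square roots
(\<open>contraction_square_root\<close>), and its polar decomposition is the closure of a graph
(\<open>unitary_equivalence_from_dense_ranges\<close>). That the ranges are dense follows from the
Lax-Milgram lemma \<open>coercive_invertible\<close> on closed subintervals, where \<open>K\<^sup>2\<close> is bounded below.
\<close>

section \<open>Operators on Hilbert spaces\<close>

lemma inner_eqI: "(\<And>z. inner x z = inner y z) \<Longrightarrow> x = (y::'a::real_inner)"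
  by (metis vector_eq_rdot)

text \<open>The Lax-Milgram lemma: for small \<open>t > 0\<close> the map \<open>x \<mapsto> x - t (X x - y)\<close> is a contraction, and its
fixed point solves \<open>X x = y\<close>. All inverse operators below come from here.\<close>

lemma coercive_invertible:
  fixes X :: "'a::{real_inner,banach} \<Rightarrow> 'a"
  assumes X: "bounded_linear X" and d: "d > 0"
    and coercive: "\<And>x. d * (norm x)\<^sup>2 \<le> inner x (X x)"
  shows "\<exists>R. bounded_linear R \<and> (\<forall>x. R (X x) = x) \<and> (\<forall>x. X (R x) = x)"
proof -
  interpret X: bounded_linear X by (rule X)
  obtain K where K: "K > 0" "\<And>x. norm (X x) \<le> norm x * K"
    using X.pos_bounded by blast
  have low: "d * norm x \<le> norm (X x)" for x
  proof (cases "x = 0")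
    case False
    have "d * norm x * norm x \<le> norm x * norm (X x)"
      using coercive[of x] norm_cauchy_schwarz[of x "X x"] by (simp add: power2_eq_square mult.assoc)
    then show ?thesis using False by simp
  qed simp
  have "d * norm x \<le> K * norm x" for x :: 'a
    using low[of x] K(2)[of x] by (simp add: mult.commute)
  then have dK: "x \<noteq> 0 \<Longrightarrow> d \<le> K" for x :: 'a
    by (metis mult_le_cancel_right_pos zero_less_norm_iff)
  have surj: "\<exists>x. X x = y" for y
  proof (cases "\<exists>x::'a. x \<noteq> 0")
    case False
    then show ?thesis by metis
  next
    case True
    then have dK: "d \<le> K" using dK by blast
    \<comment> \<open>this \<open>t\<close> minimizes the bound \<open>1 - 2 t d + t\<^sup>2 K\<^sup>2\<close> for the square of the contraction factor\<close>
    define t where "t = d / K\<^sup>2"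
    define q where "q = sqrt (1 - (d / K)\<^sup>2)"
    have t: "t > 0" using d K by (simp add: t_def)
    have q2: "0 \<le> 1 - (d / K)\<^sup>2" using d K dK by (simp add: power_le_one)
    have q: "0 \<le> q" "q < 1" using d K q2 by (auto simp: q_def)
    have contr: "norm (x - t *\<^sub>R X x) \<le> q * norm x" for x
    proof (rule power2_le_imp_le)
      have "(norm (X x))\<^sup>2 \<le> (norm x * K)\<^sup>2"
        using K(2)[of x] by (simp add: power_mono)
      then have "t\<^sup>2 * (norm (X x))\<^sup>2 \<le> t\<^sup>2 * (K\<^sup>2 * (norm x)\<^sup>2)"
        by (intro mult_left_mono) (simp_all add: power_mult_distrib mult.commute)
      also have "\<dots> = (t * d) * (norm x)\<^sup>2"
        using K d by (simp add: t_def power2_eq_square field_simps)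
      finally have 1: "t\<^sup>2 * (norm (X x))\<^sup>2 \<le> (t * d) * (norm x)\<^sup>2" .
      have 2: "(t * d) * (norm x)\<^sup>2 \<le> t * inner x (X x)"
        using coercive[of x] t by (simp add: mult.assoc)
      have "(norm (x - t *\<^sub>R X x))\<^sup>2 = (norm x)\<^sup>2 - 2 * (t * inner x (X x)) + t\<^sup>2 * (norm (X x))\<^sup>2"
        unfolding power2_norm_eq_inner
        by (simp add: inner_diff inner_commute power2_eq_square algebra_simps)
      also have "\<dots> \<le> (norm x)\<^sup>2 - (t * d) * (norm x)\<^sup>2" using 1 2 by linarith
      also have "\<dots> = (q * norm x)\<^sup>2"
        using q2 by (simp add: q_def power_mult_distrib t_def power2_eq_square field_simps)
      finally show "(norm (x - t *\<^sub>R X x))\<^sup>2 \<le> (q * norm x)\<^sup>2" .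
    qed (use q in simp)
    have "\<exists>!x. x \<in> UNIV \<and> (\<lambda>x. x - t *\<^sub>R (X x - y)) x = x"
    proof (rule Banach_fix[where c = q])
      fix u v
      have "u - t *\<^sub>R (X u - y) - (v - t *\<^sub>R (X v - y)) = (u - v) - t *\<^sub>R X (u - v)"
        by (simp add: X.diff algebra_simps)
      then show "dist (u - t *\<^sub>R (X u - y)) (v - t *\<^sub>R (X v - y)) \<le> q * dist u v"
        using contr[of "u - v"] by (simp only: dist_norm)
    qed (use q in \<open>auto simp: complete_UNIV\<close>)
    then show ?thesis using t by auto
  qed
  have inj: "inj X"
  proof (rule injI)
    fix x y assume "X x = X y"
    then have "d * norm (x - y) \<le> 0" using low[of "x - y"] by (simp add: X.diff)
    then show "x = y" using d by (simp add: mult_le_0_iff)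
  qed
  define R where "R = inv X"
  have XR: "X (R y) = y" for y
    using surj unfolding R_def by (metis f_inv_into_f rangeI)
  have RX: "R (X x) = x" for x by (simp add: R_def inj)
  have "bounded_linear R"
  proof (rule bounded_linear_intro[where K = "1 / d"])
    show "R (x + y) = R x + R y" for x y by (metis RX XR X.add)
    show "R (r *\<^sub>R x) = r *\<^sub>R R x" for r x by (metis RX XR X.scaleR)
    show "norm (R x) \<le> norm x * (1 / d)" for x
      using low[of "R x"] d by (simp add: XR field_simps)
  qed
  then show ?thesis using RX XR by blast
qed

text \<open>\<open>T\<close> itself need not be coercive, but \<open>T\<^sup>2\<close> is, since \<open>\<langle>x, T\<^sup>2 x\<rangle> = \<parallel>T x\<parallel>\<^sup>2\<close>.\<close>

lemma symmetric_bounded_below_invertible: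
  fixes T :: "'a::{real_inner,banach} \<Rightarrow> 'a"
  assumes T: "bounded_linear T" and sym: "\<And>x y. inner (T x) y = inner x (T y)"
    and d: "d > 0" and low: "\<And>x. d * norm x \<le> norm (T x)"
  shows "\<exists>R. bounded_linear R \<and> (\<forall>x. R (T x) = x) \<and> (\<forall>x. T (R x) = x)"
proof -
  interpret T: bounded_linear T by (rule T)
  have "d\<^sup>2 * (norm x)\<^sup>2 \<le> inner x (T (T x))" for x
    using power_mono[OF low[of x], of 2] d
    by (simp add: sym[symmetric] power_mult_distrib power2_norm_eq_inner)
  then obtain R where R: "bounded_linear R" "\<And>x. T (T (R x)) = x"
    using coercive_invertible[OF bounded_linear_compose[OF T T], of "d\<^sup>2"] d by auto
  have "x = y" if "T x = T y" for x y
    using low[of "x - y"] that d by (simp add: T.diff mult_le_0_iff)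
  then have "T (R (T x)) = x" for x using R(2) by blast
  then show ?thesis using R bounded_linear_compose[OF T R(1)]
    by (intro exI[of _ "\<lambda>x. T (R x)"]) auto
qed

text \<open>Polarization of the quadratic form, applied to \<open>x\<close> and to the vector of the same norm in the
direction of \<open>X x\<close>.\<close>

lemma norm_le_numerical_radius:
  fixes X :: "'a::real_inner \<Rightarrow> 'a"
  assumes X: "linear X" and sym: "\<And>x y. inner (X x) y = inner x (X y)"
    and V: "subspace V" "\<And>v. v \<in> V \<Longrightarrow> X v \<in> V"
    and r: "\<And>v. v \<in> V \<Longrightarrow> \<bar>inner v (X v)\<bar> \<le> r * (norm v)\<^sup>2" and x: "x \<in> V"
  shows "norm (X x) \<le> r * norm x"
proof (cases "X x = 0 \<or> x = 0")
  case True
  have "r \<ge> 0 \<or> x = 0" 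
    using r[OF x] by (metis abs_ge_zero order_trans zero_le_mult_iff not_less zero_less_norm_iff zero_less_power)
  then show ?thesis using True by (auto simp: linear_0[OF X])
next
  case False
  define c where "c = norm x / norm (X x)"
  define y where "y = c *\<^sub>R X x"
  have y: "y \<in> V" using V x by (simp add: y_def subspace_scale)
  have ny: "norm y = norm x" using False by (simp add: y_def c_def)
  have "4 * inner y (X x) = inner (x + y) (X (x + y)) - inner (x - y) (X (x - y))"
    using sym[of x y] sym[of y x]
    by (simp add: linear_add[OF X] linear_diff[OF X] inner_simps inner_commute)
  also have "\<dots> \<le> r * (norm (x + y))\<^sup>2 + r * (norm (x - y))\<^sup>2"
    using r[of "x + y"] r[of "x - y"] V x y by (simp add: subspace_add subspace_diff)
  also have "\<dots> = 4 * (r * (norm x)\<^sup>2)"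
    using ny by (simp add: power2_norm_eq_inner inner_simps inner_commute norm_eq algebra_simps)
  finally have "c * (norm (X x))\<^sup>2 \<le> r * (norm x)\<^sup>2"
    by (simp add: y_def power2_norm_eq_inner)
  then have "norm x * norm (X x) \<le> norm x * (r * norm x)"
    using False by (simp add: c_def power2_eq_square mult.left_commute)
  then show ?thesis using False by simp
qed

subsection \<open>Square roots\<close>

text \<open>If \<open>Z = (Y + Z\<^sup>2) / 2\<close> then \<open>(1 - Z)\<^sup>2 = 1 - Y\<close>. This fixed point is approached by iteration from
\<open>0\<close>, and for a contraction \<open>Y\<close> the increments are dominated by those of the same scalar iteration
for \<open>Y = 1\<close>, which increases to \<open>1\<close>. The iterates are polynomials in \<open>Y\<close>, so the limit commutes
with whatever commutes with \<open>Y\<close>.\<close>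

primrec root_iterate :: "('a::{real_inner,banach} \<Rightarrow>\<^sub>L 'a) \<Rightarrow> nat \<Rightarrow> 'a \<Rightarrow>\<^sub>L 'a" where
  "root_iterate Y 0 = 0"
| "root_iterate Y (Suc n) = (1/2) *\<^sub>R (Y + (root_iterate Y n o\<^sub>L root_iterate Y n))"

primrec root_majorant :: "nat \<Rightarrow> real" where
  "root_majorant 0 = 0"
| "root_majorant (Suc n) = (1 + (root_majorant n)\<^sup>2) / 2"

lemma root_majorant_bounds: "0 \<le> root_majorant n" "root_majorant n \<le> 1"
  by (induction n) (auto simp: power_le_one)

lemma root_majorant_le_Suc: "root_majorant n \<le> root_majorant (Suc n)"
proof -
  have "0 \<le> (1 - root_majorant n)\<^sup>2" by simp
  then show ?thesis by (simp add: power2_diff)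
qed

lemma root_majorant_convergent: "convergent root_majorant"
proof -
  have "Bseq root_majorant"
    by (rule BseqI'[where K = 1]) (use root_majorant_bounds in auto)
  moreover have "incseq root_majorant"
    by (rule incseq_SucI) (rule root_majorant_le_Suc)
  ultimately show ?thesis by (simp add: Bseq_mono_convergent incseqD)
qed

lemma root_iterate_norm_le:
  assumes "norm Y \<le> 1"
  shows "norm (root_iterate Y n) \<le> root_majorant n"
proof (induction n)
  case (Suc n)
  have "norm (root_iterate Y n o\<^sub>L root_iterate Y n) \<le> root_majorant n * root_majorant n"
    using norm_blinfun_compose[of "root_iterate Y n" "root_iterate Y n"] Suc
      mult_mono[OF Suc Suc] by (smt (verit) norm_ge_zero)
  then have "norm (Y + (root_iterate Y n o\<^sub>L root_iterate Y n)) \<le> 1 + (root_majorant n)\<^sup>2"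
    using assms norm_triangle_ineq[of Y "(root_iterate Y n o\<^sub>L root_iterate Y n)"]
    by (simp add: power2_eq_square)
  then show ?case by simp
qed simp

lemma root_iterate_step_le:
  assumes Y: "norm Y \<le> 1"
  shows "norm (root_iterate Y (Suc n) - root_iterate Y n) \<le> root_majorant (Suc n) - root_majorant n"
proof (induction n)
  case 0
  then show ?case using Y by simp
next
  case (Suc n)
  define a b where "a = root_iterate Y (Suc n)" and "b = root_iterate Y n"
  define u v where "u = root_majorant (Suc n)" and "v = root_majorant n"
  have ab: "norm a \<le> u" "norm b \<le> v" "norm (a - b) \<le> u - v"
    using root_iterate_norm_le[OF Y] Suc by (simp_all only: a_def b_def u_def v_def)
  \<comment> \<open>grouped so that \<open>a\<close> and \<open>b\<close> need not be known to commute\<close>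
  have "(a o\<^sub>L a) - (b o\<^sub>L b) = (a o\<^sub>L (a - b)) + ((a - b) o\<^sub>L b)"
    by (rule blinfun_eqI) (simp add: blinfun.bilinear_simps)
  then have "norm ((a o\<^sub>L a) - (b o\<^sub>L b)) \<le> norm a * norm (a - b) + norm (a - b) * norm b"
    by (metis norm_triangle_mono norm_blinfun_compose)
  also have "\<dots> \<le> u * (u - v) + (u - v) * v"
    using ab norm_ge_zero[of a] norm_ge_zero[of "a - b"]
    by (intro add_mono mult_mono) (auto intro: order_trans[OF norm_ge_zero] simp del: diff_ge_0_iff_ge)
  also have "\<dots> = u\<^sup>2 - v\<^sup>2" by (simp add: power2_eq_square algebra_simps)
  finally have le: "norm ((a o\<^sub>L a) - (b o\<^sub>L b)) \<le> u\<^sup>2 - v\<^sup>2" .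
  have "root_iterate Y (Suc (Suc n)) - root_iterate Y (Suc n)
      = (1/2) *\<^sub>R (Y + (a o\<^sub>L a)) - (1/2) *\<^sub>R (Y + (b o\<^sub>L b))"
    by (simp only: a_def b_def root_iterate.simps(2))
  also have "\<dots> = (1/2) *\<^sub>R ((a o\<^sub>L a) - (b o\<^sub>L b))" by (simp add: algebra_simps)
  finally have "norm (root_iterate Y (Suc (Suc n)) - root_iterate Y (Suc n)) \<le> (u\<^sup>2 - v\<^sup>2) / 2"
    using le by simp
  also have "\<dots> = root_majorant (Suc (Suc n)) - root_majorant (Suc n)"
    by (simp add: u_def v_def field_simps)
  finally show ?case .
qed

lemma root_iterate_convergent:
  assumes Y: "norm Y \<le> 1"
  shows "convergent (root_iterate Y)"
proof -
  have le: "norm (root_iterate Y (n + j) - root_iterate Y n) \<le> root_majorant (n + j) - root_majorant n" for n j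
  proof (induction j)
    case (Suc j)
    then show ?case
      using root_iterate_step_le[OF Y, of "n + j"]
        norm_triangle_ineq[of "root_iterate Y (Suc (n + j)) - root_iterate Y (n + j)"
          "root_iterate Y (n + j) - root_iterate Y n"]
      by (simp del: root_iterate.simps root_majorant.simps)
  qed simp
  have "Cauchy (root_iterate Y)"
  proof (rule CauchyI')
    fix e :: real assume "0 < e"
    then obtain M where M: "\<And>m n. m \<ge> M \<Longrightarrow> n \<ge> M \<Longrightarrow> norm (root_majorant m - root_majorant n) < e"
      using CauchyD[OF convergent_Cauchy[OF root_majorant_convergent]] by blast
    have "norm (root_iterate Y a - root_iterate Y b) < e" if ab: "M \<le> a" "a < b" for a b
    proof -
      obtain j where j: "b = a + j" using ab by (metis less_imp_le le_Suc_ex)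
      have "norm (root_iterate Y b - root_iterate Y a) \<le> \<bar>root_majorant b - root_majorant a\<bar>"
        using order_trans[OF le[of a j] abs_ge_self] unfolding j .
      also have "\<dots> < e" using M[of b a] ab by simp
      finally show ?thesis by (metis norm_minus_commute)
    qed
    then show "\<exists>M. \<forall>m\<ge>M. \<forall>n>m. dist (root_iterate Y m) (root_iterate Y n) < e"
      unfolding dist_norm by blast
  qed
  then show ?thesis by (simp add: Cauchy_convergent_iff)
qed

text \<open>The root is taken of \<open>1 - Y\<close>. That it commutes with the commutant of \<open>Y\<close> makes it compatible with
other operators and, through multiplication by scalars, with the complex structure.\<close>

lemma contraction_square_root:
  fixes Y :: "'a::{real_inner,banach} \<Rightarrow> 'a"
  assumes Y: "bounded_linear Y" and sym: "\<And>x y. inner (Y x) y = inner x (Y y)"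
    and contr: "\<And>x. norm (Y x) \<le> norm x"
  obtains W where "bounded_linear W" "\<And>x y. inner (W x) y = inner x (W y)"
    "\<And>x. W (W x) = x - Y x"
    "\<And>X x. bounded_linear X \<Longrightarrow> (\<And>x. X (Y x) = Y (X x)) \<Longrightarrow> X (W x) = W (X x)"
proof -
  define B where "B = Blinfun Y"
  have B: "blinfun_apply B = Y" by (simp add: B_def bounded_linear_Blinfun_apply Y)
  have "norm B \<le> 1" by (rule norm_blinfun_bound) (use contr B in auto)
  then obtain Z where Z: "root_iterate B \<longlonglongrightarrow> Z"
    using root_iterate_convergent by (auto simp: convergent_def)
  have Zx: "(\<lambda>n. root_iterate B n x) \<longlonglongrightarrow> Z x" for x
    by (intro tendsto_intros Z)
  have "(\<lambda>n. root_iterate B (Suc n)) \<longlonglongrightarrow> (1/2) *\<^sub>R (B + (Z o\<^sub>L Z))"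
    unfolding root_iterate.simps by (intro tendsto_intros Z)
  then have fixZ: "Z = (1/2) *\<^sub>R (B + (Z o\<^sub>L Z))"
    using LIMSEQ_unique LIMSEQ_Suc[OF Z] by blast
  have ZZ: "Z (Z x) = 2 *\<^sub>R Z x - Y x" for x
    using arg_cong[OF fixZ, of "\<lambda>T. 2 *\<^sub>R T x"] by (simp add: blinfun.bilinear_simps B)
  have symn: "inner (root_iterate B n x) y = inner x (root_iterate B n y)" for n x y
    by (induction n arbitrary: x y) (auto simp: blinfun.bilinear_simps B sym inner_simps)
  have symZ: "inner (Z x) y = inner x (Z y)" for x y
    by (rule LIMSEQ_unique[OF tendsto_inner[OF Zx tendsto_const]])
      (simp add: symn tendsto_inner[OF tendsto_const Zx])
  define W where "W x = x - Z x" for x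
  show ?thesis
  proof
    show "bounded_linear W" unfolding W_def by (intro bounded_linear_intros)
    show "inner (W x) y = inner x (W y)" for x y by (simp add: W_def inner_diff symZ)
    show "W (W x) = x - Y x" for x
      by (simp add: W_def blinfun.bilinear_simps ZZ scaleR_2)
    fix X x assume X: "bounded_linear X" and com: "\<And>x. X (Y x) = Y (X x)"
    interpret X: bounded_linear X by (rule X)
    have "X (root_iterate B n x) = root_iterate B n (X x)" for n x
      by (induction n arbitrary: x) (auto simp: blinfun.bilinear_simps B X.add X.scaleR com)
    then have "(\<lambda>n. root_iterate B n (X x)) \<longlonglongrightarrow> X (Z x)"
      using X.tendsto[OF Zx[of x]] by simp
    then have "X (Z x) = Z (X x)" using LIMSEQ_unique Zx by blast
    then show "X (W x) = W (X x)" by (simp add: W_def X.diff)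
  qed
qed

subsection \<open>The complex structure\<close>

instance complex_hilbert_space \<subseteq> banach ..

lemma scaleC_zero_right [simp]: "c *\<^sub>C (0::'a::complex_hilbert_space) = 0"
  using scaleC_add_right[of c "0::'a" 0] by simp

lemma scaleC_one [simp]: "1 *\<^sub>C (x::'a::complex_hilbert_space) = x"
  using scaleC_of_real[of 1 x] by simp

lemma scaleC_scaleR_commute: "c *\<^sub>C (r *\<^sub>R x) = r *\<^sub>R (c *\<^sub>C (x::'a::complex_hilbert_space))"
  by (simp flip: scaleC_of_real add: scaleC_scaleC mult.commute)

lemma scaleC_minus_right: "c *\<^sub>C (- x) = - (c *\<^sub>C (x::'a::complex_hilbert_space))"
  using scaleC_scaleR_commute[of c "-1" x] by simp

lemma scaleC_diff_right: "c *\<^sub>C (x - y) = c *\<^sub>C x - c *\<^sub>C (y::'a::complex_hilbert_space)"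
  using scaleC_add_right[of c x "- y"] by (simp add: scaleC_minus_right)

lemma scaleC_sum_right: "c *\<^sub>C (\<Sum>i\<in>I. f i) = (\<Sum>i\<in>I. c *\<^sub>C (f i::'a::complex_hilbert_space))"
  by (induction I rule: infinite_finite_induct) (auto simp: scaleC_add_right)

lemma cinner_scaleC_left: "cinner (c *\<^sub>C x) y = cnj c * cinner x (y::'a::complex_hilbert_space)"
  using cinner_commute[of "c *\<^sub>C x" y] cinner_commute[of x y] by (simp add: cinner_scaleC_right)

lemma cinner_self: "cinner x x = complex_of_real ((norm (x::'a::complex_hilbert_space))\<^sup>2)"
proof -
  have "Im (cinner x x) = 0" using arg_cong[OF cinner_commute[of x x], of Im] by simp
  then show ?thesis
    by (simp add: complex_eq_iff power2_norm_eq_inner inner_eq_Re_cinner)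
qed

lemma norm_scaleC: "norm (c *\<^sub>C x) = cmod c * norm (x::'a::complex_hilbert_space)"
proof -
  have "complex_of_real ((norm (c *\<^sub>C x))\<^sup>2) = cnj c * c * complex_of_real ((norm x)\<^sup>2)"
    unfolding cinner_self[symmetric] by (simp add: cinner_scaleC_left cinner_scaleC_right mult.assoc)
  also have "\<dots> = complex_of_real ((cmod c * norm x)\<^sup>2)"
    by (simp add: mult.commute[of "cnj c"] complex_norm_square[symmetric] power_mult_distrib)
  finally have "(norm (c *\<^sub>C x))\<^sup>2 = (cmod c * norm x)\<^sup>2" by (simp only: of_real_eq_iff)
  then show ?thesis by (rule power2_eq_imp_eq) auto
qed

lemma bounded_linear_scaleC: "bounded_linear (\<lambda>x::'a::complex_hilbert_space. c *\<^sub>C x)"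
  by (rule bounded_linear_intro[where K = "cmod c"])
    (auto simp: scaleC_add_right scaleC_scaleR_commute norm_scaleC mult.commute)

text \<open>The complex inner product is determined by the real one, so a complex-linear map that preserves
the latter preserves the former.\<close>

lemma cinner_from_inner:
  "cinner x y = Complex (inner x y) (- inner x (\<i> *\<^sub>C (y::'a::complex_hilbert_space)))"
  by (simp add: complex_eq_iff inner_eq_Re_cinner cinner_scaleC_right)

lemma cinner_zero_right [simp]: "cinner x (0::'a::complex_hilbert_space) = 0"
  by (simp add: cinner_from_inner complex_eq_iff)

lemma cinner_diff_right: "cinner x (y - z) = cinner x y - cinner x (z::'a::complex_hilbert_space)"
  using cinner_add_right[of x "y - z" z] by simp

lemma bounded_clinearD:
  assumes "bounded_clinear T"
  shows "bounded_linear T" "T (c *\<^sub>C x) = c *\<^sub>C T x"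
  using assms by (auto simp: bounded_clinear_def)

text \<open>A maximal orthonormal subset of \<open>V\<close>, by Zorn's lemma: a nonzero vector of \<open>V\<close> orthogonal to it could
be normalized and added.\<close>

lemma orthonormal_basis_exists:
  fixes V :: "'a::complex_hilbert_space set"
  assumes V: "\<And>c x. x \<in> V \<Longrightarrow> c *\<^sub>C x \<in> V"
  shows "\<exists>B. orthonormal_basis V B"
proof -
  define F where "F = {B. B \<subseteq> V \<and> (\<forall>b\<in>B. \<forall>c\<in>B. cinner b c = (if b = c then 1 else 0))}"
  have "\<exists>M\<in>F. \<forall>X\<in>F. M \<subseteq> X \<longrightarrow> X = M"
  proof (rule subset_Zorn_nonempty)
    show "F \<noteq> {}" by (auto simp: F_def)
    fix \<C> assume ne: "\<C> \<noteq> {}" and ch: "subset.chain F \<C>"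
    have "\<exists>X\<in>\<C>. b \<in> X \<and> c \<in> X" if "b \<in> \<Union>\<C>" "c \<in> \<Union>\<C>" for b c
      using that ch unfolding subset.chain_def subset_chain_def by blast
    moreover have "X \<in> F" if "X \<in> \<C>" for X using ch that by (auto simp: subset_chain_def)
    ultimately show "\<Union>\<C> \<in> F" unfolding F_def by blast
  qed
  then obtain M where M: "M \<in> F" "\<And>X. X \<in> F \<Longrightarrow> M \<subseteq> X \<Longrightarrow> X = M" by blast
  have "x = 0" if x: "x \<in> V" "\<forall>b\<in>M. cinner b x = 0" for x
  proof (rule ccontr)
    assume "x \<noteq> 0"
    define e where "e = complex_of_real (1 / norm x) *\<^sub>C x"
    have e1: "cinner e e = 1"
      using \<open>x \<noteq> 0\<close> by (simp add: cinner_self e_def norm_scaleC norm_divide)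
    have e0: "cinner b e = 0" "cinner e b = 0" if "b \<in> M" for b
      using x(2) that cinner_commute[of x b]
      by (auto simp: e_def cinner_scaleC_right cinner_scaleC_left)
    have "insert e M \<in> F"
      using M(1) e0 e1 V[OF x(1)] unfolding F_def by (auto simp: e_def)
    then have "e \<in> M" using M(2) by blast
    then show False using e0 e1 by fastforce
  qed
  then show ?thesis using M(1) unfolding orthonormal_basis_def F_def by blast
qed

lemma same_dimension_if_unitary:
  fixes V :: "'a::complex_hilbert_space set" and W :: "'b::complex_hilbert_space set"
  assumes V: "\<And>c x. x \<in> V \<Longrightarrow> c *\<^sub>C x \<in> V"
    and U: "U ` V = W" "\<And>x y. x \<in> V \<Longrightarrow> y \<in> V \<Longrightarrow> cinner (U x) (U y) = cinner x y"
  shows "same_dimension V W"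
proof -
  obtain B where B: "orthonormal_basis V B" using orthonormal_basis_exists V by blast
  then have BV: "B \<subseteq> V" and ons: "\<And>b c. b \<in> B \<Longrightarrow> c \<in> B \<Longrightarrow> cinner b c = (if b = c then 1 else 0)"
    and max: "\<And>x. x \<in> V \<Longrightarrow> (\<And>b. b \<in> B \<Longrightarrow> cinner b x = 0) \<Longrightarrow> x = 0"
    by (auto simp: orthonormal_basis_def)
  have eq: "cinner (U b) (U c) = (if b = c then 1 else 0)" if "b \<in> B" "c \<in> B" for b c
  proof -
    have "cinner (U b) (U c) = cinner b c" using that BV U(2) by blast
    then show ?thesis using ons that by simp
  qed
  have inj: "inj_on U B"
    using eq by (intro inj_onI) (metis one_neq_zero)
  have "orthonormal_basis W (U ` B)"
    unfolding orthonormal_basis_def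
  proof (intro conjI ballI impI)
    show "U ` B \<subseteq> W" using BV U(1) by blast
    show "cinner b c = (if b = c then 1 else 0)" if "b \<in> U ` B" "c \<in> U ` B" for b c
      using that eq inj by (auto simp: inj_on_eq_iff)
    fix y assume y: "y \<in> W" "\<forall>b\<in>U ` B. cinner b y = 0"
    then obtain x where x: "x \<in> V" "y = U x" using U(1) by blast
    have "x = 0" using y(2) x U(2) BV by (intro max) (auto simp: subset_iff)
    then have "cinner y y = 0" using U(2)[of x x] x by simp
    then show "y = 0" by (simp add: cinner_self)
  qed
  then show ?thesis
    unfolding same_dimension_def using B inj_on_image_eqpoll_self[OF inj] eqpoll_sym by blast
qed

text \<open>The closure of the pairs \<open>(L x, C x)\<close> with \<open>x \<in> V\<close>. When \<open>L\<close> and \<open>C\<close> have the same norms on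
\<open>V\<close>, this is the graph of the isometry \<open>L x \<mapsto> C x\<close>, extended to the closure of \<open>L ` V\<close>.\<close>

definition graph_limit :: "'a::complex_hilbert_space set \<Rightarrow> ('a \<Rightarrow> 'a) \<Rightarrow> ('a \<Rightarrow> 'a) \<Rightarrow> 'a \<Rightarrow> 'a \<Rightarrow> bool" where
  "graph_limit V L C x u \<longleftrightarrow>
     (\<exists>\<xi>. (\<forall>n. \<xi> n \<in> V) \<and> (\<lambda>n::nat. L (\<xi> n)) \<longlonglongrightarrow> x \<and> (\<lambda>n. C (\<xi> n)) \<longlonglongrightarrow> u)"

lemma graph_limit_swap: "graph_limit V L C x u \<Longrightarrow> graph_limit V C L u x"
  by (auto simp: graph_limit_def)

text \<open>If \<open>L (\<xi> n)\<close> converges then \<open>C (\<xi> n)\<close> is a Cauchy sequence, because \<open>C\<close> and \<open>L\<close> agree in norm on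
differences.\<close>

lemma graph_limit_total:
  assumes V: "subspace V" and L: "bounded_linear L" and C: "bounded_linear C"
    and iso: "\<And>x y. x \<in> V \<Longrightarrow> y \<in> V \<Longrightarrow> inner (L x) (L y) = inner (C x) (C y)"
    and x: "x \<in> closure (L ` V)"
  shows "\<exists>u \<in> closure (C ` V). graph_limit V L C x u"
proof -
  interpret L: bounded_linear L by (rule L)
  interpret C: bounded_linear C by (rule C)
  obtain \<eta> where \<eta>: "\<And>n. \<eta> n \<in> L ` V" "\<eta> \<longlonglongrightarrow> x"
    using x closure_sequential by blast
  then have "\<forall>n. \<exists>v\<in>V. \<eta> n = L v" by blast
  then obtain \<xi> where \<xi>: "\<And>n. \<xi> n \<in> V" "\<And>n. \<eta> n = L (\<xi> n)" by metis
  have iso': "norm (C (\<xi> a) - C (\<xi> b)) = norm (\<eta> a - \<eta> b)" for a b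
    using iso[of "\<xi> a - \<xi> b" "\<xi> a - \<xi> b"] \<xi> V
    by (simp add: L.diff C.diff norm_eq subspace_diff)
  have "Cauchy \<eta>" using \<eta>(2) LIMSEQ_imp_Cauchy by blast
  then have "Cauchy (\<lambda>n. C (\<xi> n))" unfolding Cauchy_def dist_norm iso' .
  then obtain u where u: "(\<lambda>n. C (\<xi> n)) \<longlonglongrightarrow> u"
    using Cauchy_convergent_iff convergent_def by blast
  then have "u \<in> closure (C ` V)"
    unfolding closure_sequential using \<xi>(1) by (intro exI[of _ "\<lambda>n. C (\<xi> n)"]) simp
  moreover have "graph_limit V L C x u"
    unfolding graph_limit_def using \<xi>(1) \<eta>(2)[unfolded \<xi>(2)[abs_def]] u by blast
  ultimately show ?thesis by blast
qed

text \<open>The unitary factor of a polar decomposition, where \<open>L\<close> plays the absolute value of \<open>C\<close>: the map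
\<open>L x \<mapsto> C x\<close> is isometric with dense domain and dense range, and all its algebraic properties pass to
the closure of its graph. Surjectivity is totality of the graph read in the other direction.\<close>

lemma unitary_equivalence_from_dense_ranges:
  fixes V W :: "'a::complex_hilbert_space set"
  assumes V: "subspace V" "closed V" "\<And>c x. x \<in> V \<Longrightarrow> c *\<^sub>C x \<in> V" and W: "closed W"
    and L: "bounded_clinear L" "L ` V \<subseteq> V" "V \<subseteq> closure (L ` V)"
    and C: "bounded_clinear C" "C ` V \<subseteq> W" "W \<subseteq> closure (C ` V)"
    and iso: "\<And>x y. x \<in> V \<Longrightarrow> y \<in> V \<Longrightarrow> inner (L x) (L y) = inner (C x) (C y)"
    and T: "bounded_linear T" "T ` V \<subseteq> V" and S: "bounded_linear S" "S ` W \<subseteq> W"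
    and LT: "\<And>x. x \<in> V \<Longrightarrow> L (T x) = T (L x)" and CT: "\<And>x. x \<in> V \<Longrightarrow> C (T x) = S (C x)"
  shows "unitarily_equivalent_on V T W S"
proof -
  interpret L: bounded_linear L by (rule bounded_clinearD(1)[OF L(1)])
  interpret C: bounded_linear C by (rule bounded_clinearD(1)[OF C(1)])
  interpret T: bounded_linear T by (rule T(1))
  interpret S: bounded_linear S by (rule S(1))
  have clV: "closure (L ` V) = V" and clW: "closure (C ` V) = W"
    by (rule subset_antisym[OF closure_minimal[OF L(2) V(2)] L(3)])
      (rule subset_antisym[OF closure_minimal[OF C(2) W] C(3)])
  let ?G = "graph_limit V L C"
  have add: "?G (x + y) (u + v)" if G: "?G x u" "?G y v" for x y u v
  proof -
    obtain \<xi> \<eta> where "\<forall>n. \<xi> n \<in> V" "(\<lambda>n. L (\<xi> n)) \<longlonglongrightarrow> x" "(\<lambda>n. C (\<xi> n)) \<longlonglongrightarrow> u"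
      "\<forall>n. \<eta> n \<in> V" "(\<lambda>n. L (\<eta> n)) \<longlonglongrightarrow> y" "(\<lambda>n. C (\<eta> n)) \<longlonglongrightarrow> v"
      using G unfolding graph_limit_def by blast
    then show ?thesis unfolding graph_limit_def
      by (intro exI[of _ "\<lambda>n. \<xi> n + \<eta> n"])
        (simp add: L.add C.add tendsto_add subspace_add[OF V(1)])
  qed
  have scale: "?G (c *\<^sub>C x) (c *\<^sub>C u)" if G: "?G x u" for c x u
  proof -
    obtain \<xi> where "\<forall>n. \<xi> n \<in> V" "(\<lambda>n. L (\<xi> n)) \<longlonglongrightarrow> x" "(\<lambda>n. C (\<xi> n)) \<longlonglongrightarrow> u"
      using G unfolding graph_limit_def by blast
    then show ?thesis unfolding graph_limit_def
      by (intro exI[of _ "\<lambda>n. c *\<^sub>C \<xi> n"])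
        (simp add: bounded_clinearD(2)[OF L(1)] bounded_clinearD(2)[OF C(1)] V(3)
          bounded_linear.tendsto[OF bounded_linear_scaleC])
  qed
  have apply_T: "?G (T x) (S u)" if G: "?G x u" for x u
  proof -
    obtain \<xi> where "\<forall>n. \<xi> n \<in> V" "(\<lambda>n. L (\<xi> n)) \<longlonglongrightarrow> x" "(\<lambda>n. C (\<xi> n)) \<longlonglongrightarrow> u"
      using G unfolding graph_limit_def by blast
    then show ?thesis unfolding graph_limit_def using T(2)
      by (intro exI[of _ "\<lambda>n. T (\<xi> n)"]) (auto simp: LT CT T.tendsto S.tendsto)
  qed
  have inner: "inner u v = inner x y" if G: "?G x u" "?G y v" for x y u v
  proof -
    obtain \<xi> \<eta> where lim: "\<forall>n. \<xi> n \<in> V" "(\<lambda>n. L (\<xi> n)) \<longlonglongrightarrow> x" "(\<lambda>n. C (\<xi> n)) \<longlonglongrightarrow> u"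
      "\<forall>n. \<eta> n \<in> V" "(\<lambda>n. L (\<eta> n)) \<longlonglongrightarrow> y" "(\<lambda>n. C (\<eta> n)) \<longlonglongrightarrow> v"
      using G unfolding graph_limit_def by blast
    have "(\<lambda>n. inner (C (\<xi> n)) (C (\<eta> n))) \<longlonglongrightarrow> inner x y"
      using tendsto_inner[OF lim(2,5)] lim(1,4) by (simp add: iso)
    then show ?thesis using LIMSEQ_unique tendsto_inner[OF lim(3,6)] by blast
  qed
  have unique: "u = v" if "?G x u" "?G x v" for x u v
  proof -
    have "?G (x + (-1) *\<^sub>C x) (u + (-1) *\<^sub>C v)" using that add scale by blast
    then have "?G 0 (u - v)"
      using scaleC_of_real[of "-1" x] scaleC_of_real[of "-1" v] by simp
    from inner[OF this this] show ?thesis by simp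
  qed
  have "\<exists>u\<in>W. ?G x u" if "x \<in> V" for x
    using graph_limit_total[OF V(1) L.bounded_linear C.bounded_linear iso] that clV clW by auto
  then obtain U where U: "\<And>x. x \<in> V \<Longrightarrow> U x \<in> W" "\<And>x. x \<in> V \<Longrightarrow> ?G x (U x)" by metis
  have eqU: "U x = u" if "x \<in> V" "?G x u" for x u using unique U that by blast
  have surj: "\<exists>x\<in>V. U x = u" if u: "u \<in> W" for u
  proof -
    obtain x where "x \<in> V" "graph_limit V C L u x"
      using graph_limit_total[OF V(1) C.bounded_linear L.bounded_linear, of u] iso u clV clW by auto
    then show ?thesis using eqU graph_limit_swap by blast
  qed
  have Uinner: "inner (U x) (U y) = inner x y" if "x \<in> V" "y \<in> V" for x y
    using inner U(2) that by blast
  have Uadd: "U (x + y) = U x + U y" if "x \<in> V" "y \<in> V" for x y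
    using that U(2) add subspace_add[OF V(1)] by (intro eqU) auto
  have Uscale: "U (c *\<^sub>C x) = c *\<^sub>C U x" if "x \<in> V" for c x
    using that U(2) scale V(3) by (intro eqU) auto
  have inj: "inj_on U V"
  proof (rule inj_onI)
    fix x y assume xy: "x \<in> V" "y \<in> V" "U x = U y"
    have "inner x z = inner y z" if "z \<in> V" for z
      using Uinner[of x z] Uinner[of y z] xy that by simp
    from this[of "x - y"] have "inner (x - y) (x - y) = 0"
      using xy subspace_diff[OF V(1)] by (simp add: inner_diff_left)
    then show "x = y" by simp
  qed
  show ?thesis unfolding unitarily_equivalent_on_def
  proof (intro conjI exI[of _ U] ballI allI)
    show "bij_betw U V W" using inj surj U(1) unfolding bij_betw_def by blast
    show "cinner (U x) (U y) = cinner x y" if "x \<in> V" "y \<in> V" for x y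
      using that V(3) unfolding cinner_from_inner by (simp add: Uinner flip: Uscale)
    show "U (T x) = S (U x)" if "x \<in> V" for x
      using that T(2) apply_T U(2) by (intro eqU) auto
  qed (use Uadd Uscale T S in auto)
qed

subsection \<open>Orthogonal projections\<close>

lemma orthogonal_projectionD:
  fixes P :: "'a::complex_hilbert_space \<Rightarrow> 'a"
  assumes "orthogonal_projection P"
  shows "bounded_linear P" "P (c *\<^sub>C x) = c *\<^sub>C P x" "P (P x) = P x" "inner (P x) y = inner x (P y)"
  using assms
  by (auto simp: orthogonal_projection_def bounded_clinear_def inner_eq_Re_cinner fun_eq_iff)

lemma orthogonal_projection_pythagoras:
  fixes P :: "'a::complex_hilbert_space \<Rightarrow> 'a"
  assumes "orthogonal_projection P"
  shows "(norm (P x))\<^sup>2 = inner x (P x)" "(norm x)\<^sup>2 = (norm (P x))\<^sup>2 + (norm (x - P x))\<^sup>2"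
proof -
  note P = orthogonal_projectionD[OF assms]
  have 1: "inner (P x) (P x) = inner x (P x)" by (simp add: P)
  then show "(norm (P x))\<^sup>2 = inner x (P x)" by (simp add: power2_norm_eq_inner)
  show "(norm x)\<^sup>2 = (norm (P x))\<^sup>2 + (norm (x - P x))\<^sup>2"
    unfolding power2_norm_eq_inner using 1 by (simp add: inner_diff inner_commute)
qed

lemma orthogonal_projection_norm_le:
  fixes P :: "'a::complex_hilbert_space \<Rightarrow> 'a"
  assumes "orthogonal_projection P"
  shows "norm (P x) \<le> norm x"
  by (rule power2_le_imp_le) (simp_all add: orthogonal_projection_pythagoras(2)[OF assms, of x])

lemma orthogonal_projection_reflection_norm:
  fixes P :: "'a::complex_hilbert_space \<Rightarrow> 'a"
  assumes "orthogonal_projection P"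
  shows "norm (2 *\<^sub>R P x - x) = norm x"
proof (rule power2_eq_imp_eq)
  have "inner (P x) (P x) = inner x (P x)" by (simp add: orthogonal_projectionD[OF assms])
  then show "(norm (2 *\<^sub>R P x - x))\<^sup>2 = (norm x)\<^sup>2"
    unfolding power2_norm_eq_inner by (simp add: inner_diff inner_commute)
qed auto

lemma orthogonal_projection_absorb:
  fixes P Q :: "'a::complex_hilbert_space \<Rightarrow> 'a"
  assumes P: "orthogonal_projection P" and Q: "orthogonal_projection Q"
    and PQ: "\<And>x. P (Q x) = P x"
  shows "Q (P x) = P x"
proof -
  have "inner (Q (P x)) y = inner (P x) y" for y
    by (simp add: orthogonal_projectionD[OF P] orthogonal_projectionD[OF Q] PQ)
  then show ?thesis by (metis vector_eq_ldot inner_commute)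
qed

lemma orthogonal_projection_id: "orthogonal_projection (\<lambda>x::'a::complex_hilbert_space. x)"
  by (simp add: orthogonal_projection_def bounded_clinear_def fun_eq_iff)

lemma orthogonal_projection_zero: "orthogonal_projection (\<lambda>x::'a::complex_hilbert_space. 0)"
proof -
  have "cinner 0 x = 0" for x :: 'a using cinner_commute[of 0 x] by simp
  then show ?thesis by (simp add: orthogonal_projection_def bounded_clinear_def fun_eq_iff)
qed

section \<open>Spectral subspaces of a bounded self-adjoint operator\<close>

text \<open>Two things are needed from a spectral measure: the bounds for the form \<open>\<langle>x, A x\<rangle>\<close> on the range of
\<open>E B\<close>, and a description of the range of \<open>E {a..b}\<close> in terms of \<open>A\<close> alone. The second one says how
operators that commute or anticommute with a shift of \<open>A\<close> act on spectral subspaces; it replaces a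
functional calculus.\<close>

locale spectral_resolution =
  fixes A :: "'a::complex_hilbert_space \<Rightarrow> 'a" and E :: "real set \<Rightarrow> 'a \<Rightarrow> 'a"
  assumes A: "bounded_linear A" and A_sym: "inner (A x) y = inner x (A y)"
    and spectral: "spectral_measure_of A E"
begin

sublocale A: bounded_linear A by (rule A)

lemma E_projection: "B \<in> sets borel \<Longrightarrow> orthogonal_projection (E B)"
  and E_empty [simp]: "E {} x = 0"
  and E_UNIV [simp]: "E UNIV x = x"
  and E_Int: "B \<in> sets borel \<Longrightarrow> C \<in> sets borel \<Longrightarrow> E B (E C x) = E (B \<inter> C) x"
  and E_sums: "range F \<subseteq> sets borel \<Longrightarrow> disjoint_family F \<Longrightarrow> (\<lambda>n. E (F n) x) sums E (\<Union>n. F n) x"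
  for F :: "nat \<Rightarrow> real set"
  using spectral by (auto simp: spectral_measure_of_def projection_valued_measure_def)

lemmas E_bounded_linear = orthogonal_projectionD(1)[OF E_projection]
lemmas E_sym = orthogonal_projectionD(4)[OF E_projection]

lemma E_Un:
  assumes "B \<in> sets borel" "C \<in> sets borel" "B \<inter> C = {}"
  shows "E (B \<union> C) x = E B x + E C x"
proof -
  have "(\<lambda>n. E (binaryset B C n) x) sums E (\<Union>n. binaryset B C n) x"
    by (rule E_sums)
      (use assms in \<open>auto simp: range_binaryset_eq disjoint_family_on_def binaryset_def\<close>)
  moreover have "(\<lambda>n. E (binaryset B C n) x) sums (E B x + E C x)"
    by (rule binaryset_sums) simp
  ultimately show ?thesis by (metis UN_binaryset_eq sums_unique2)
qed

lemma E_Compl: "B \<in> sets borel \<Longrightarrow> E (- B) x = x - E B x"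
  using E_Un[of B "- B" x] by (simp add: Compl_partition eq_diff_eq add.commute)

lemma E_mono: "B \<in> sets borel \<Longrightarrow> C \<in> sets borel \<Longrightarrow> B \<subseteq> C \<Longrightarrow> E B x = x \<Longrightarrow> E C x = x"
  by (metis E_Int Int_absorb1)

abbreviation \<mu> :: "'a \<Rightarrow> real measure" where "\<mu> \<equiv> scalar_spectral_measure E"

lemma sets_\<mu> [simp, measurable_cong]: "sets (\<mu> x) = sets borel"
  and space_\<mu> [simp]: "space (\<mu> x) = UNIV"
  using sets.sigma_sets_eq[of borel]
  by (auto simp: scalar_spectral_measure_def sets_measure_of_conv space_measure_of_conv)

lemma emeasure_\<mu>:
  assumes "B \<in> sets borel"
  shows "emeasure (\<mu> x) B = ennreal ((norm (E B x))\<^sup>2)"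
proof -
  let ?f = "\<lambda>B. ennreal (Re (cinner x (E B x)))"
  have nonneg: "0 \<le> inner x (E B x)" if "B \<in> sets borel" for B
    using orthogonal_projection_pythagoras(1)[OF E_projection[OF that], of x]
    by (metis zero_le_power2)
  have "emeasure (\<mu> x) B = ?f B"
  proof (rule emeasure_measure_of[OF scalar_spectral_measure_def])
    show "positive (sets (\<mu> x)) ?f" by (simp add: positive_def)
    show "countably_additive (sets (\<mu> x)) ?f"
      unfolding countably_additive_def inner_eq_Re_cinner[symmetric]
    proof (intro allI impI)
      fix F :: "nat \<Rightarrow> real set"
      assume F: "range F \<subseteq> sets (\<mu> x)" "disjoint_family F"
      have "(\<lambda>n. inner x (E (F n) x)) sums inner x (E (\<Union>n. F n) x)"
        using F by (intro bounded_linear.sums[OF bounded_linear_inner_right] E_sums) auto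
      then show "(\<Sum>n. ennreal (inner x (E (F n) x))) = ennreal (inner x (E (\<Union> (range F)) x))"
        using F nonneg by (intro suminf_ennreal_eq) auto
    qed
  qed (use assms in auto)
  then show ?thesis
    by (simp add: orthogonal_projection_pythagoras(1)[OF E_projection[OF assms]] inner_eq_Re_cinner)
qed

lemma finite_measure_\<mu>: "finite_measure (\<mu> x)"
  by (rule finite_measureI) (simp add: emeasure_\<mu>)

lemma measure_\<mu>: "B \<in> sets borel \<Longrightarrow> measure (\<mu> x) B = (norm (E B x))\<^sup>2"
  by (simp add: measure_def emeasure_\<mu>)

lemma AE_\<mu>_if_in_range:
  assumes "B \<in> sets borel" "E B x = x"
  shows "AE t in \<mu> x. t \<in> B"
  by (rule AE_I[where N = "- B"]) (use assms in \<open>auto simp: emeasure_\<mu> E_Compl\<close>)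

lemma integrable_id: "integrable (\<mu> x) (\<lambda>t. t)"
proof -
  obtain r where "E {-r..r} = id" using spectral by (auto simp: spectral_measure_of_def)
  then have "AE t in \<mu> x. t \<in> {-r..r}" by (intro AE_\<mu>_if_in_range) auto
  then have "AE t in \<mu> x. norm t \<le> r" by (rule AE_mp) (auto intro!: AE_I2)
  then show ?thesis
    by (intro finite_measure.integrable_const_bound[OF finite_measure_\<mu>]) auto
qed

lemma form_eq: "inner x (A x) = (\<integral>t. t \<partial>\<mu> x)"
  using spectral by (simp add: spectral_measure_of_def inner_eq_Re_cinner)

text \<open>The measure of \<open>E B x\<close> is that of \<open>x\<close> restricted to \<open>B\<close>.\<close>

lemma form_restrict:
  assumes B: "B \<in> sets borel"
  shows "inner (E B x) (A (E B x)) = (\<integral>t. indicator B t *\<^sub>R t \<partial>\<mu> x)"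
proof -
  have "\<mu> (E B x) = density (\<mu> x) (indicator B)"
    by (rule measure_eqI)
      (use B in \<open>auto simp: emeasure_\<mu> emeasure_restricted E_Int Int_commute\<close>)
  also have "\<dots> = density (\<mu> x) (\<lambda>t. ennreal (indicator B t))"
    by (simp add: ennreal_indicator)
  finally have "(\<integral>t. t \<partial>\<mu> (E B x)) = (\<integral>t. t \<partial>density (\<mu> x) (\<lambda>t. ennreal (indicator B t)))"
    by simp
  also have "\<dots> = (\<integral>t. indicator B t *\<^sub>R t \<partial>\<mu> x)"
    using B by (intro integral_density) auto
  finally show ?thesis by (simp add: form_eq)
qed

lemma form_split:
  assumes B: "B \<in> sets borel"
  shows "inner x (A x) = inner (E B x) (A (E B x)) + inner (E (- B) x) (A (E (- B) x))"
proof -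
  have int: "integrable (\<mu> x) (\<lambda>t. indicator C t *\<^sub>R t)" if "C \<in> sets borel" for C
    using that by (intro integrable_mult_indicator integrable_id) simp
  have "(\<integral>t. t \<partial>\<mu> x) = (\<integral>t. indicator B t *\<^sub>R t + indicator (- B) t *\<^sub>R t \<partial>\<mu> x)"
    by (rule arg_cong[where f = "integral\<^sup>L (\<mu> x)"]) (auto simp: indicator_def)
  also have "\<dots> = (\<integral>t. indicator B t *\<^sub>R t \<partial>\<mu> x) + (\<integral>t. indicator (- B) t *\<^sub>R t \<partial>\<mu> x)"
    using B by (intro Bochner_Integration.integral_add int) auto
  also have "\<dots> = inner (E B x) (A (E B x)) + inner (E (- B) x) (A (E (- B) x))"
    using form_restrict[OF B, of x] form_restrict[of "- B" x] B by simp
  finally show ?thesis by (simp add: form_eq)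
qed

text \<open>The form of \<open>A\<close> splits along \<open>B\<close> and its complement, so its off-diagonal part vanishes and the range
of \<open>E B\<close> reduces \<open>A\<close>.\<close>

lemma E_commutes_A:
  assumes B: "B \<in> sets borel"
  shows "E B (A x) = A (E B x)"
proof -
  have B': "- B \<in> sets borel" using B by simp
  have orth: "inner u (A v) = 0" if uv: "E B u = u" "E B v = 0" for u v
  proof -
    interpret EB: bounded_linear "E B" by (rule E_bounded_linear[OF B])
    have "E B (u + v) = u" "E (- B) (u + v) = v"
      using uv B by (auto simp: EB.add E_Compl)
    then have "inner (u + v) (A (u + v)) = inner u (A u) + inner v (A v)"
      using form_split[OF B, of "u + v"] by simp
    then have "inner u (A v) + inner v (A u) = 0" by (simp add: A.add inner_simps)
    moreover have "inner v (A u) = inner u (A v)" by (metis A_sym inner_commute)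
    ultimately show ?thesis by simp
  qed
  interpret EB: bounded_linear "E B" by (rule E_bounded_linear[OF B])
  have EE: "E B (E B y) = E B y" for y using B by (simp add: E_Int)
  have off: "E B (A v) = 0" if "E B v = 0" for v
  proof -
    have "inner (E B (A v)) (A v) = 0" using that EE by (intro orth)
    then have "inner (E B (A v)) (E B (A v)) = 0"
      using E_sym[OF B, of "E B (A v)" "A v"] EE by simp
    then show ?thesis by simp
  qed
  have "A (E B x) - E B (A (E B x)) = 0"
  proof -
    define w where "w = A (E B x) - E B (A (E B x))"
    have w: "E B w = 0" by (simp add: w_def EB.diff EE)
    have "inner w w = inner w (A (E B x)) - inner w (E B (A (E B x)))"
      by (simp add: w_def inner_diff_right)
    also have "inner w (A (E B x)) = inner (E B x) (A w)" by (metis A_sym inner_commute)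
    also have "\<dots> = 0" using w EE by (intro orth)
    also have "inner w (E B (A (E B x))) = 0" using w E_sym[OF B, of w] by simp
    finally show ?thesis by (simp add: w_def)
  qed
  moreover have "E B (A (x - E B x)) = 0" by (rule off) (simp add: EB.diff EE)
  ultimately show ?thesis by (simp add: A.diff EB.diff)
qed

lemma form_ge:
  assumes B: "B \<in> sets borel" "B \<subseteq> {b..}" and x: "E B x = x"
  shows "b * (norm x)\<^sup>2 \<le> inner x (A x)"
proof -
  interpret finite_measure "\<mu> x" by (rule finite_measure_\<mu>)
  have "AE t in \<mu> x. t \<in> B" by (rule AE_\<mu>_if_in_range[OF B(1) x])
  then have "AE t in \<mu> x. b \<le> t" by (rule AE_mp) (use B in \<open>auto intro!: AE_I2\<close>)
  then have "(\<integral>t. b \<partial>\<mu> x) \<le> (\<integral>t. t \<partial>\<mu> x)"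
    by (intro integral_mono_AE integrable_id) auto
  then show ?thesis by (simp add: form_eq measure_\<mu> mult.commute)
qed

lemma form_le:
  assumes B: "B \<in> sets borel" "B \<subseteq> {..b}" and x: "E B x = x"
  shows "inner x (A x) \<le> b * (norm x)\<^sup>2"
proof -
  interpret finite_measure "\<mu> x" by (rule finite_measure_\<mu>)
  have "AE t in \<mu> x. t \<in> B" by (rule AE_\<mu>_if_in_range[OF B(1) x])
  then have "AE t in \<mu> x. t \<le> b" by (rule AE_mp) (use B in \<open>auto intro!: AE_I2\<close>)
  then have "(\<integral>t. t \<partial>\<mu> x) \<le> (\<integral>t. b \<partial>\<mu> x)"
    by (intro integral_mono_AE integrable_id) auto
  then show ?thesis by (simp add: form_eq measure_\<mu> mult.commute)
qed

text \<open>For \<open>\<rho> > 0\<close> the form of \<open>A - c\<close> on the range of \<open>E B\<close> has a constant sign and is at least \<open>\<rho> \<parallel>x\<parallel>\<^sup>2\<close> in absolute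
value; the Cauchy-Schwarz inequality turns this into a bound for the norm.\<close>

lemma shift_bounded_below:
  assumes B: "B \<in> sets borel" "B \<subseteq> {b..} \<and> \<rho> \<le> b - c \<or> B \<subseteq> {..b} \<and> \<rho> \<le> c - b"
    and x: "E B x = x"
  shows "\<rho> * norm x \<le> norm (A x - c *\<^sub>R x)"
proof (cases "x = 0")
  case False
  have "\<rho> * (norm x)\<^sup>2 \<le> \<bar>inner x (A x - c *\<^sub>R x)\<bar>"
    using B(2)
  proof
    assume "B \<subseteq> {b..} \<and> \<rho> \<le> b - c"
    then have "b * (norm x)\<^sup>2 \<le> inner x (A x)" "\<rho> * (norm x)\<^sup>2 \<le> (b - c) * (norm x)\<^sup>2"
      using form_ge[OF B(1) _ x] by (auto intro: mult_right_mono)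
    then show ?thesis by (simp add: inner_diff_right power2_norm_eq_inner algebra_simps)
  next
    assume "B \<subseteq> {..b} \<and> \<rho> \<le> c - b"
    then have "inner x (A x) \<le> b * (norm x)\<^sup>2" "\<rho> * (norm x)\<^sup>2 \<le> (c - b) * (norm x)\<^sup>2"
      using form_le[OF B(1) _ x] by (auto intro: mult_right_mono)
    then show ?thesis by (simp add: inner_diff_right power2_norm_eq_inner algebra_simps)
  qed
  also have "\<dots> \<le> norm x * norm (A x - c *\<^sub>R x)" by (rule Cauchy_Schwarz_ineq2)
  finally have "norm x * (\<rho> * norm x) \<le> norm x * norm (A x - c *\<^sub>R x)"
    by (simp add: power2_eq_square mult.left_commute)
  then show ?thesis using False by simp
qed simp

lemma E_tendsto_Union:
  assumes F: "\<And>n. F n \<in> sets borel" "incseq F"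
  shows "(\<lambda>n. E (F n) x) \<longlonglongrightarrow> E (\<Union>n. F n) x"
proof -
  let ?U = "\<Union>n. F n"
  have U: "?U \<in> sets borel" using F by auto
  interpret finite_measure "\<mu> x" by (rule finite_measure_\<mu>)
  have "(\<lambda>n. measure (\<mu> x) (F n)) \<longlonglongrightarrow> measure (\<mu> x) ?U"
    by (rule finite_Lim_measure_incseq) (use F in auto)
  then have lim: "(\<lambda>n. (norm (E ?U x))\<^sup>2 - (norm (E (F n) x))\<^sup>2) \<longlonglongrightarrow> 0"
    using F U by (subst (asm) LIM_zero_iff[symmetric]) (auto simp: measure_\<mu> dest: tendsto_minus)
  have "(norm (E ?U x))\<^sup>2 - (norm (E (F n) x))\<^sup>2 = (norm (E (F n) x - E ?U x))\<^sup>2" for n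
  proof -
    have "F n \<inter> ?U = F n" by blast
    then show ?thesis
      using orthogonal_projection_pythagoras(2)[OF E_projection[OF F(1)], of "E ?U x" n]
      by (simp add: E_Int F U norm_minus_commute)
  qed
  with lim have "(\<lambda>n. (norm (E (F n) x - E ?U x))\<^sup>2) \<longlonglongrightarrow> 0" by simp
  from tendsto_real_sqrt[OF this] have "(\<lambda>n. norm (E (F n) x - E ?U x)) \<longlonglongrightarrow> 0" by simp
  then show ?thesis using LIM_zero_iff tendsto_norm_zero_iff by blast
qed

definition shift_power :: "real \<Rightarrow> nat \<Rightarrow> 'a \<Rightarrow> 'a" where
  "shift_power c n = (\<lambda>x. A x - c *\<^sub>R x) ^^ n"

lemma shift_power_simps [simp]:
  "shift_power c 0 x = x"
  "shift_power c (Suc n) x = A (shift_power c n x) - c *\<^sub>R shift_power c n x"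
  by (simp_all add: shift_power_def)

lemma E_shift_power: "B \<in> sets borel \<Longrightarrow> E B (shift_power c n x) = shift_power c n (E B x)"
  by (induction n)
    (simp_all add: linear_diff[OF bounded_linear.linear[OF E_bounded_linear]] E_commutes_A
      linear_scale[OF bounded_linear.linear[OF E_bounded_linear]])

text \<open>On the range of \<open>E B\<close> the powers of \<open>A - c\<close> grow at least like \<open>\<rho> ^ n\<close>, while those applied to \<open>x\<close>
grow at most like \<open>r ^ n\<close> with \<open>r < \<rho>\<close>; the component of \<open>x\<close> in that range must vanish.\<close>

lemma E_eq_zero_if_slow_growth:
  assumes B: "B \<in> sets borel" "\<And>y. E B y = y \<Longrightarrow> \<rho> * norm y \<le> norm (A y - c *\<^sub>R y)"
    and r: "0 \<le> r" "r < \<rho>" and growth: "\<And>n. norm (shift_power c n x) \<le> K * r ^ n"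
  shows "E B x = 0"
proof -
  have EE: "E B (E B x) = E B x" using B by (simp add: E_Int)
  have "\<rho> ^ n * norm (E B x) \<le> norm (shift_power c n (E B x))" for n
  proof (induction n)
    case (Suc n)
    have "\<rho> ^ Suc n * norm (E B x) = \<rho> * (\<rho> ^ n * norm (E B x))" by simp
    also have "\<dots> \<le> \<rho> * norm (shift_power c n (E B x))"
      using Suc r by (intro mult_left_mono) auto
    also have "\<dots> \<le> norm (shift_power c (Suc n) (E B x))"
      using B(2)[of "shift_power c n (E B x)"] B(1) EE by (simp add: E_shift_power)
    finally show ?case .
  qed simp
  also have "norm (shift_power c n (E B x)) \<le> K * r ^ n" for n
    using orthogonal_projection_norm_le[OF E_projection[OF B(1)], of "shift_power c n x"]
      growth[of n] B(1) by (simp add: E_shift_power)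
  finally have "norm (E B x) \<le> K * (r / \<rho>) ^ n" for n
    using r by (simp add: power_divide field_simps)
  moreover have "(\<lambda>n. K * (r / \<rho>) ^ n) \<longlonglongrightarrow> K * 0"
    by (intro tendsto_intros LIMSEQ_power_zero) (use r in auto)
  ultimately have "norm (E B x) \<le> K * 0" by (intro LIMSEQ_le_const) auto
  then show ?thesis by simp
qed

text \<open>The spectral subspace of a closed interval with centre \<open>c\<close> and radius \<open>r\<close> consists of the vectors on
which the powers of \<open>A - c\<close> grow at most like \<open>r ^ n\<close>. One direction is the bound \<open>r\<close> for the norm of
\<open>A - c\<close> on this subspace; the other exhausts the complement by half-lines at distance more than \<open>r\<close>
from \<open>c\<close>.\<close>

lemma in_interval_range_iff:
  assumes ab: "a \<le> b"
  shows "E {a..b} x = x \<longleftrightarrow>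
    (\<exists>K. \<forall>n. norm (shift_power ((a + b) / 2) n x) \<le> K * ((b - a) / 2) ^ n)"
    (is "_ \<longleftrightarrow> ?growth")
proof
  let ?c = "(a + b) / 2" and ?r = "(b - a) / 2"
  assume x: "E {a..b} x = x"
  define V where "V = {y. E {a..b} y = y}"
  have E: "linear (E {a..b})" by (simp add: E_bounded_linear bounded_linear.linear)
  have V: "subspace V"
    by (auto simp: V_def subspace_def linear_0[OF E] linear_add[OF E] linear_scale[OF E])
  let ?X = "\<lambda>y. A y - ?c *\<^sub>R y"
  have X: "linear ?X" by (intro bounded_linear.linear bounded_linear_intros A)
  have XV: "?X y \<in> V" if "y \<in> V" for y
    using that by (simp add: V_def linear_diff[OF E] linear_scale[OF E] E_commutes_A)
  have symX: "inner (?X y) z = inner y (?X z)" for y z by (simp add: inner_diff A_sym)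
  have le: "\<bar>inner y (?X y)\<bar> \<le> ?r * (norm y)\<^sup>2" if "y \<in> V" for y
  proof -
    have "a * (norm y)\<^sup>2 \<le> inner y (A y)" "inner y (A y) \<le> b * (norm y)\<^sup>2"
      using that form_ge[of "{a..b}" a y] form_le[of "{a..b}" b y] by (auto simp: V_def)
    then show ?thesis
      by (simp add: inner_diff_right power2_norm_eq_inner abs_le_iff field_simps)
  qed
  have step: "norm (?X y) \<le> ?r * norm y" if "y \<in> V" for y
    by (rule norm_le_numerical_radius[OF X symX V XV le that])
  have "shift_power ?c n x \<in> V \<and> norm (shift_power ?c n x) \<le> norm x * ?r ^ n" for n
  proof (induction n)
    case (Suc n)
    have "norm (shift_power ?c (Suc n) x) \<le> ?r * norm (shift_power ?c n x)"
      using step Suc by simp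
    also have "\<dots> \<le> ?r * (norm x * ?r ^ n)"
      using Suc ab by (intro mult_left_mono) auto
    finally show ?case using Suc XV by (simp add: mult_ac)
  qed (use x in \<open>simp add: V_def\<close>)
  then show ?growth by blast
next
  let ?c = "(a + b) / 2" and ?r = "(b - a) / 2"
  assume ?growth
  then obtain K where K: "\<And>n. norm (shift_power ?c n x) \<le> K * ?r ^ n" by blast
  define \<epsilon> where "\<epsilon> n = 1 / real (Suc n)" for n
  have \<epsilon>: "\<epsilon> n > 0" "m \<le> n \<Longrightarrow> \<epsilon> n \<le> \<epsilon> m" for m n by (auto simp: \<epsilon>_def field_simps)
  have small: "\<exists>n. \<epsilon> n \<le> d" if "d > 0" for d
    using reals_Archimedean[OF that] by (auto simp: \<epsilon>_def inverse_eq_divide intro: less_imp_le)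
  have "E {b + \<epsilon> n..} x = 0" for n
    using ab \<epsilon>(1)[of n] shift_bounded_below[of "{b + \<epsilon> n..}" "b + \<epsilon> n" "b + \<epsilon> n - ?c" ?c]
    by (intro E_eq_zero_if_slow_growth[of _ "b + \<epsilon> n - ?c" ?c ?r, OF _ _ _ _ K]) (auto simp: field_simps)
  moreover have "(\<lambda>n. E {b + \<epsilon> n..} x) \<longlonglongrightarrow> E (\<Union>n. {b + \<epsilon> n..}) x"
    by (intro E_tendsto_Union) (auto simp: incseq_def \<epsilon> intro: order_trans[rotated])
  moreover have "(\<Union>n. {b + \<epsilon> n..}) = {b<..}"
  proof (intro subset_antisym subsetI)
    fix t assume "t \<in> {b<..}"
    then obtain n where "\<epsilon> n \<le> t - b" using small[of "t - b"] by auto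
    then show "t \<in> (\<Union>n. {b + \<epsilon> n..})" by (auto intro!: exI[of _ n])
  next
    fix t assume "t \<in> (\<Union>n. {b + \<epsilon> n..})"
    then obtain n where "b + \<epsilon> n \<le> t" by auto
    then show "t \<in> {b<..}" using \<epsilon>(1)[of n] by simp
  qed
  ultimately have right: "E {b<..} x = 0" by (simp add: LIMSEQ_const_iff)
  have "E {..a - \<epsilon> n} x = 0" for n
    using ab \<epsilon>(1)[of n] shift_bounded_below[of "{..a - \<epsilon> n}" "a - \<epsilon> n" "?c - (a - \<epsilon> n)" ?c]
    by (intro E_eq_zero_if_slow_growth[of _ "?c - (a - \<epsilon> n)" ?c ?r, OF _ _ _ _ K]) (auto simp: field_simps)
  moreover have "(\<lambda>n. E {..a - \<epsilon> n} x) \<longlonglongrightarrow> E (\<Union>n. {..a - \<epsilon> n}) x"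
    by (intro E_tendsto_Union) (auto simp: incseq_def intro: order_trans \<epsilon>)
  moreover have "(\<Union>n. {..a - \<epsilon> n}) = {..<a}"
  proof (intro subset_antisym subsetI)
    fix t assume "t \<in> {..<a}"
    then obtain n where "\<epsilon> n \<le> a - t" using small[of "a - t"] by auto
    then show "t \<in> (\<Union>n. {..a - \<epsilon> n})" by (auto intro!: exI[of _ n])
  next
    fix t assume "t \<in> (\<Union>n. {..a - \<epsilon> n})"
    then obtain n where "t \<le> a - \<epsilon> n" by auto
    then show "t \<in> {..<a}" using \<epsilon>(1)[of n] by simp
  qed
  ultimately have left: "E {..<a} x = 0" by (simp add: LIMSEQ_const_iff)
  have "x - E {a..b} x = E (- {a..b}) x" by (simp add: E_Compl)
  also have "- {a..b} = {..<a} \<union> {b<..}" by auto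
  also have "E \<dots> x = 0" using ab left right by (subst E_Un) auto
  finally show "E {a..b} x = x" by simp
qed

text \<open>A bounded operator that carries \<open>A - c\<close> to plus or minus \<open>A - c'\<close> preserves growth rates of powers.\<close>

lemma intertwiner_maps_range:
  assumes X: "bounded_linear X"
    and tw: "\<And>x. X (A x - ((a + b) / 2) *\<^sub>R x) = \<sigma> *\<^sub>R (A (X x) - ((a' + b') / 2) *\<^sub>R X x)"
    and \<sigma>: "\<bar>\<sigma>\<bar> = 1" and len: "b' - a' = b - a" and ab: "a \<le> b" and x: "E {a..b} x = x"
  shows "E {a'..b'} (X x) = X x"
proof -
  interpret X: bounded_linear X by (rule X)
  obtain K where K: "\<And>n. norm (shift_power ((a + b) / 2) n x) \<le> K * ((b - a) / 2) ^ n"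
    using in_interval_range_iff[OF ab] x by blast
  obtain M where M: "M > 0" "\<And>x. norm (X x) \<le> norm x * M" using X.pos_bounded by blast
  have pow: "\<sigma> ^ n *\<^sub>R shift_power ((a' + b') / 2) n (X x) = X (shift_power ((a + b) / 2) n x)" for n
  proof (induction n)
    case (Suc n)
    let ?y = "shift_power ((a' + b') / 2) n (X x)"
    have "X (shift_power ((a + b) / 2) (Suc n) x)
        = \<sigma> *\<^sub>R (A (\<sigma> ^ n *\<^sub>R ?y) - ((a' + b') / 2) *\<^sub>R (\<sigma> ^ n *\<^sub>R ?y))"
      unfolding Suc by (simp only: shift_power_simps tw)
    also have "\<dots> = \<sigma> ^ Suc n *\<^sub>R shift_power ((a' + b') / 2) (Suc n) (X x)"
      by (simp add: A.scaleR scaleR_diff_right mult.commute)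
    finally show ?case by simp
  qed simp
  have "norm (shift_power ((a' + b') / 2) n (X x)) \<le> (K * M) * ((b' - a') / 2) ^ n" for n
  proof -
    have "norm (shift_power ((a' + b') / 2) n (X x)) = norm (X (shift_power ((a + b) / 2) n x))"
      unfolding pow[symmetric] by (simp add: power_abs \<sigma>)
    also have "\<dots> \<le> norm (shift_power ((a + b) / 2) n x) * M" by (rule M(2))
    also have "\<dots> \<le> (K * ((b - a) / 2) ^ n) * M" using K M(1) by (intro mult_right_mono) auto
    finally show ?thesis using len by (simp add: mult_ac)
  qed
  then show ?thesis using in_interval_range_iff[of a' b'] ab len by auto
qed

lemma commuting_maps_range:
  assumes "bounded_linear X" "\<And>x. X (A x) = A (X x)" "a \<le> b" "E {a..b} x = x"
  shows "E {a..b} (X x) = X x"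
  using assms bounded_linear.linear[OF assms(1)]
  by (intro intertwiner_maps_range[where X = X and \<sigma> = 1 and a = a and b = b, OF assms(1)])
    (simp_all add: linear_diff linear_scale)

lemma reflecting_maps_range:
  assumes "bounded_linear X" "\<And>x. X (A x) = s *\<^sub>R X x - A (X x)" "a \<le> b" "E {a..b} x = x"
  shows "E {s - b..s - a} (X x) = X x"
proof (rule intertwiner_maps_range[where X = X and \<sigma> = "-1" and a = a and b = b])
  have lin: "linear X" by (rule bounded_linear.linear[OF assms(1)])
  have "s *\<^sub>R y = ((a + b) / 2) *\<^sub>R y + ((s - b + (s - a)) / 2) *\<^sub>R y" for y :: 'a
    by (simp flip: scaleR_add_left add: field_simps)
  then show "X (A y - ((a + b) / 2) *\<^sub>R y) = - 1 *\<^sub>R (A (X y) - ((s - b + (s - a)) / 2) *\<^sub>R X y)" for y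
    by (simp add: linear_diff[OF lin] linear_scale[OF lin] assms(2))
qed (use assms(1,3,4) in auto)

text \<open>Closed subintervals exhaust the open interval. This is the passage from the growth criterion, which
speaks of closed intervals, to the open intervals of the continuous part of the spectrum.\<close>

lemma open_interval_range_approx:
  assumes ab: "a < b" and x: "E {a<..<b} x = x"
  obtains \<xi> where "\<xi> \<longlonglongrightarrow> x"
    "\<And>n::nat. \<exists>a' b'. a < a' \<and> a' \<le> b' \<and> b' < b \<and> E {a'..b'} (\<xi> n) = \<xi> n"
proof -
  define \<epsilon> where "\<epsilon> n = (b - a) / real (n + 2)" for n
  have anti: "\<epsilon> n \<le> \<epsilon> m" if "m \<le> n" for m n
    unfolding \<epsilon>_def by (rule divide_left_mono) (use that ab in auto)
  have \<epsilon>: "\<epsilon> n > 0" "2 * \<epsilon> n \<le> b - a" for n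
  proof -
    show "\<epsilon> n > 0" using ab by (simp add: \<epsilon>_def)
    have "\<epsilon> 0 = (b - a) / 2" by (simp add: \<epsilon>_def)
    then show "2 * \<epsilon> n \<le> b - a" using anti[of 0 n] by simp
  qed
  have small: "\<exists>n. \<epsilon> n \<le> d" if d: "d > 0" for d
  proof -
    obtain n where "(b - a) / d < real n" using reals_Archimedean2 by blast
    then have "\<epsilon> n \<le> d" using d ab by (simp add: \<epsilon>_def field_simps)
    then show ?thesis by blast
  qed
  have un: "(\<Union>n. {a + \<epsilon> n..b - \<epsilon> n}) = {a<..<b}"
  proof (intro subset_antisym subsetI)
    fix t assume t: "t \<in> {a<..<b}"
    then obtain n where "\<epsilon> n \<le> min (t - a) (b - t)" using small[of "min (t - a) (b - t)"] by auto
    then show "t \<in> (\<Union>n. {a + \<epsilon> n..b - \<epsilon> n})" by (auto intro!: exI[of _ n])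
  next
    fix t assume "t \<in> (\<Union>n. {a + \<epsilon> n..b - \<epsilon> n})"
    then obtain n where "a + \<epsilon> n \<le> t" "t \<le> b - \<epsilon> n" by auto
    then show "t \<in> {a<..<b}" using \<epsilon>(1)[of n] by simp
  qed
  have "incseq (\<lambda>n. {a + \<epsilon> n..b - \<epsilon> n})"
  proof (rule monoI)
    fix m n :: nat assume "m \<le> n"
    then show "{a + \<epsilon> m..b - \<epsilon> m} \<subseteq> {a + \<epsilon> n..b - \<epsilon> n}" using anti[of m n] by auto
  qed
  then have "(\<lambda>n. E {a + \<epsilon> n..b - \<epsilon> n} x) \<longlonglongrightarrow> x"
    using E_tendsto_Union[of "\<lambda>n. {a + \<epsilon> n..b - \<epsilon> n}" x] x un by simp
  moreover have "\<exists>a' b'. a < a' \<and> a' \<le> b' \<and> b' < b \<and> E {a'..b'} (E {a + \<epsilon> n..b - \<epsilon> n} x) = E {a + \<epsilon> n..b - \<epsilon> n} x" for n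
    using \<epsilon>(1,2)[of n] by (intro exI[of _ "a + \<epsilon> n"] exI[of _ "b - \<epsilon> n"]) (auto simp: E_Int)
  ultimately show ?thesis using that by blast
qed

lemma range_E_eq: "B \<in> sets borel \<Longrightarrow> range (E B) = {x. E B x = x}"
  by (auto simp: E_Int) (metis rangeI)

lemma closed_range_E: "B \<in> sets borel \<Longrightarrow> closed {x. E B x = x}"
  by (intro closed_Collect_eq linear_continuous_on E_bounded_linear continuous_on_id)

lemma maps_open_range:
  assumes X: "bounded_linear X" and ab: "a < b"
    and closed_case: "\<And>c d y. a < c \<Longrightarrow> c \<le> d \<Longrightarrow> d < b \<Longrightarrow> E {c..d} y = y \<Longrightarrow> E B (X y) = X y"
    and B: "B \<in> sets borel" and x: "E {a<..<b} x = x"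
  shows "E B (X x) = X x"
proof -
  obtain \<xi> where \<xi>: "\<xi> \<longlonglongrightarrow> x"
    "\<And>n::nat. \<exists>a' b'. a < a' \<and> a' \<le> b' \<and> b' < b \<and> E {a'..b'} (\<xi> n) = \<xi> n"
    using open_interval_range_approx[OF ab x] by blast
  have "X (\<xi> n) \<in> {x. E B x = x}" for n using \<xi>(2) closed_case by blast
  then show ?thesis
    using closed_sequentially[OF closed_range_E[OF B] _ bounded_linear.tendsto[OF X \<xi>(1)]] by blast
qed

end

section \<open>The spectrum of a symmetric operator\<close>

text \<open>For nonreal \<open>z\<close> the form of \<open>A - z\<close> has imaginary part \<open>- Im z \<parallel>x\<parallel>\<^sup>2\<close>; multiplication by a suitable
unit turns this into coercivity.\<close>

lemma symmetric_spectrum_real: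
  fixes A :: "'a::complex_hilbert_space \<Rightarrow> 'a"
  assumes A: "bounded_clinear A" and sym: "\<And>x y. inner (A x) y = inner x (A y)"
    and z: "z \<in> spectrum A"
  shows "Im z = 0"
proof (rule ccontr)
  assume im: "Im z \<noteq> 0"
  interpret A: bounded_linear A by (rule bounded_clinearD(1)[OF A])
  define u where "u = \<i> * complex_of_real (sgn (Im z))"
  have u: "u \<noteq> 0" using im by (simp add: u_def sgn_zero_iff)
  have real: "Im (cinner x (A x)) = 0" for x
  proof -
    have "Im (cinner x (A x)) = Im (cinner (A x) x)"
      by (simp add: cinner_from_inner sym bounded_clinearD(2)[OF A])
    also have "\<dots> = - Im (cinner x (A x))" by (subst cinner_commute) simp
    finally show ?thesis by simp
  qed
  define X where "X x = u *\<^sub>C (A x - z *\<^sub>C x)" for x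
  have X: "bounded_linear X" unfolding X_def
    by (intro bounded_linear_compose[OF bounded_linear_scaleC] bounded_linear_sub A.bounded_linear
        bounded_linear_scaleC)
  have form: "inner x (X x) = \<bar>Im z\<bar> * (norm x)\<^sup>2" for x
  proof -
    have "cinner x (X x) = u * cinner x (A x) - u * z * cinner x x"
      by (simp add: X_def scaleC_diff_right scaleC_scaleC cinner_scaleC_right cinner_diff_right)
    then show ?thesis
      using real[of x]
      by (simp add: inner_eq_Re_cinner[of x "X x"] u_def cinner_self abs_sgn mult.commute)
  qed
  obtain R where R: "bounded_linear R" "\<And>x. R (X x) = x" "\<And>x. X (R x) = x"
    using coercive_invertible[OF X, of "\<bar>Im z\<bar>"] im form by auto
  define R' where "R' x = R (u *\<^sub>C x)" for x
  have left: "R' (A x - z *\<^sub>C x) = x" for x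
    using R(2)[of x] by (simp add: R'_def X_def)
  have right: "A (R' x) - z *\<^sub>C R' x = x" for x
  proof -
    have "u *\<^sub>C (A (R' x) - z *\<^sub>C R' x) = u *\<^sub>C x"
      using R(3)[of "u *\<^sub>C x"] by (simp add: X_def R'_def)
    then have "inverse u *\<^sub>C u *\<^sub>C (A (R' x) - z *\<^sub>C R' x) = inverse u *\<^sub>C u *\<^sub>C x" by simp
    then show ?thesis using u by (simp add: scaleC_scaleC)
  qed
  have "bounded_linear R'"
    unfolding R'_def by (rule bounded_linear_compose[OF R(1) bounded_linear_scaleC])
  moreover have "R' (c *\<^sub>C x) = c *\<^sub>C R' x" for c x
  proof -
    have "c *\<^sub>C x = A (c *\<^sub>C R' x) - z *\<^sub>C c *\<^sub>C R' x"
      using arg_cong[OF right[of x], of "\<lambda>y. c *\<^sub>C y"]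
      by (simp only: bounded_clinearD(2)[OF A] scaleC_diff_right scaleC_scaleC mult.commute)
    then show ?thesis using left[of "c *\<^sub>C R' x"] by simp
  qed
  ultimately have "z \<notin> spectrum A"
    unfolding spectrum_def bounded_clinear_def using left right by blast
  with z show False by blast
qed

lemma bounded_below_not_in_spectrum:
  fixes A :: "'a::complex_hilbert_space \<Rightarrow> 'a"
  assumes A: "bounded_clinear A" and sym: "\<And>x y. inner (A x) y = inner x (A y)"
    and d: "d > 0" and low: "\<And>x. d * norm x \<le> norm (A x - z *\<^sub>R x)"
  shows "complex_of_real z \<notin> spectrum A"
proof -
  note A' = bounded_clinearD[OF A]
  have "bounded_linear (\<lambda>x. A x - z *\<^sub>R x)"
    by (intro bounded_linear_intros A')
  then obtain R where R: "bounded_linear R" "\<And>x. R (A x - z *\<^sub>R x) = x"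
      "\<And>x. A (R x) - z *\<^sub>R R x = x"
    using symmetric_bounded_below_invertible[of "\<lambda>x. A x - z *\<^sub>R x", OF _ _ d low]
    by (auto simp: inner_diff sym)
  have "R (c *\<^sub>C x) = c *\<^sub>C R x" for c x
  proof -
    have "c *\<^sub>C x = A (c *\<^sub>C R x) - z *\<^sub>R c *\<^sub>C R x"
      using arg_cong[OF R(3)[of x], of "\<lambda>y. c *\<^sub>C y"]
      by (simp add: A'(2) scaleC_diff_right scaleC_scaleR_commute)
    then show ?thesis using R(2)[of "c *\<^sub>C R x"] by simp
  qed
  then show ?thesis
    unfolding spectrum_def bounded_clinear_def using R by (auto simp: scaleC_of_real)
qed

section \<open>Chains of projections with one incomparable pair\<close>

text \<open>The Hilbert representation in terms of operators: \<open>p j\<close> belongs to the element of level \<open>j \<noteq> k\<close>,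
and \<open>P1\<close>, \<open>P2\<close> to the two incomparable elements. Each \<open>p j\<close> commutes with all the others, and \<open>P1\<close>
need not commute with \<open>P2\<close>.\<close>

locale one_parameter_projections =
  fixes m k :: nat and p :: "nat \<Rightarrow> 'a::complex_hilbert_space \<Rightarrow> 'a" and P1 P2 :: "'a \<Rightarrow> 'a"
    and \<alpha> :: "nat \<Rightarrow> real" and a1 a2 :: real
  assumes k: "1 \<le> k" "k \<le> m"
    and p: "\<And>j. j \<in> {1..m} - {k} \<Longrightarrow> orthogonal_projection (p j)"
    and P1: "orthogonal_projection P1" and P2: "orthogonal_projection P2"
    and chain: "\<And>i j x. i \<in> {1..m} - {k} \<Longrightarrow> j \<in> {1..m} - {k} \<Longrightarrow> i < j \<Longrightarrow> p i (p j x) = p i x"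
    and low: "\<And>i x. 1 \<le> i \<Longrightarrow> i < k \<Longrightarrow> p i (P1 x) = p i x" "\<And>i x. 1 \<le> i \<Longrightarrow> i < k \<Longrightarrow> p i (P2 x) = p i x"
    and high: "\<And>j x. k < j \<Longrightarrow> j \<le> m \<Longrightarrow> P1 (p j x) = P1 x" "\<And>j x. k < j \<Longrightarrow> j \<le> m \<Longrightarrow> P2 (p j x) = P2 x"
    and \<alpha>: "\<And>j. j \<in> {1..m} - {k} \<Longrightarrow> \<alpha> j > 0" and a1: "a1 > 0" and a2: "a2 > 0"
begin

definition A :: "'a \<Rightarrow> 'a" where
  "A x = (\<Sum>j\<in>{1..m} - {k}. \<alpha> j *\<^sub>R p j x) + a1 *\<^sub>R P1 x + a2 *\<^sub>R P2 x"

definition c :: real where "c = (\<Sum>j=k+1..m. \<alpha> j)"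

definition s :: real where "s = a1 + a2 + 2 * c"

text \<open>Half the commutator of the incomparable projections; the factor makes it a contraction. It
intertwines \<open>A\<close> with \<open>s - A\<close> and is the source of the symmetry of the spectrum.\<close>

definition K :: "'a \<Rightarrow> 'a" where "K x = (1/2) *\<^sub>R (P1 (P2 x) - P2 (P1 x))"

text \<open>The neighbours of the pair in the chain, completed by the identity on top and by \<open>0\<close> at the bottom.
The operators \<open>P1\<close> and \<open>P2\<close> act nontrivially only on the difference of their ranges, the middle
block.\<close>

definition upper :: "'a \<Rightarrow> 'a" where "upper = (if k = m then (\<lambda>x. x) else p (k + 1))"

definition lower :: "'a \<Rightarrow> 'a" where "lower = (if k = 1 then (\<lambda>x. 0) else p (k - 1))"

definition middle :: "'a set" where "middle = {x. upper x = x \<and> lower x = 0}"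

sublocale P1: bounded_linear P1 by (rule orthogonal_projectionD(1)[OF P1])
sublocale P2: bounded_linear P2 by (rule orthogonal_projectionD(1)[OF P2])

lemmas P1_simps = orthogonal_projectionD(2,3)[OF P1]
lemmas P2_simps = orthogonal_projectionD(2,3)[OF P2]

lemma p_linear: "j \<in> {1..m} - {k} \<Longrightarrow> linear (p j)"
  using orthogonal_projectionD(1)[OF p] bounded_linear.linear by blast

lemma chain': "i \<in> {1..m} - {k} \<Longrightarrow> j \<in> {1..m} - {k} \<Longrightarrow> i < j \<Longrightarrow> p j (p i x) = p i x"
  by (rule orthogonal_projection_absorb[OF p p]) (simp_all add: chain)

lemma low': "1 \<le> i \<Longrightarrow> i < k \<Longrightarrow> P1 (p i x) = p i x" "1 \<le> i \<Longrightarrow> i < k \<Longrightarrow> P2 (p i x) = p i x"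
  using orthogonal_projection_absorb[OF p P1] orthogonal_projection_absorb[OF p P2] low k by auto

lemma high': "k < j \<Longrightarrow> j \<le> m \<Longrightarrow> p j (P1 x) = P1 x" "k < j \<Longrightarrow> j \<le> m \<Longrightarrow> p j (P2 x) = P2 x"
  using orthogonal_projection_absorb[OF P1 p] orthogonal_projection_absorb[OF P2 p] high k by auto

lemma p_idem: "i \<in> {1..m} - {k} \<Longrightarrow> p i (p i x) = p i x"
  using orthogonal_projectionD(3)[OF p] by blast

lemma p_min:
  assumes "i \<in> {1..m} - {k}" "j \<in> {1..m} - {k}"
  shows "p i (p j x) = p (min i j) x"
  using assms chain[of i j x] chain'[of j i x] p_idem by (cases i j rule: linorder_cases) auto

lemma A_bounded_linear: "bounded_linear A"
proof -
  have scale: "bounded_linear (\<lambda>x. r *\<^sub>R f x)" if "bounded_linear f" for r and f :: "'a \<Rightarrow> 'a"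
    by (rule bounded_linear_compose[OF bounded_linear_scaleR_right that])
  have "bounded_linear (\<lambda>x. \<Sum>j\<in>{1..m} - {k}. \<alpha> j *\<^sub>R p j x)"
  proof (rule bounded_linear_sum)
    fix j assume "j \<in> {1..m} - {k}"
    then show "bounded_linear (\<lambda>x. \<alpha> j *\<^sub>R p j x)"
      using scale[of "p j" "\<alpha> j"] orthogonal_projectionD(1)[OF p] by blast
  qed
  from bounded_linear_add[OF bounded_linear_add[OF this scale[OF P1.bounded_linear]]
      scale[OF P2.bounded_linear]]
  show ?thesis unfolding A_def[abs_def] .
qed

sublocale A: bounded_linear A by (rule A_bounded_linear)

lemma A_clinear: "bounded_clinear A"
  unfolding bounded_clinear_def
proof (intro conjI allI A_bounded_linear)
  fix d x
  have "(\<Sum>j\<in>{1..m} - {k}. \<alpha> j *\<^sub>R p j (d *\<^sub>C x)) = d *\<^sub>C (\<Sum>j\<in>{1..m} - {k}. \<alpha> j *\<^sub>R p j x)"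
    unfolding scaleC_sum_right
    by (intro sum.cong refl) (simp add: orthogonal_projectionD(2)[OF p] scaleC_scaleR_commute)
  then show "A (d *\<^sub>C x) = d *\<^sub>C A x"
    by (simp add: A_def P1_simps P2_simps scaleC_add_right scaleC_scaleR_commute)
qed

lemma A_sym: "inner (A x) y = inner x (A y)"
proof -
  have "(\<Sum>j\<in>{1..m} - {k}. \<alpha> j * inner (p j x) y) = (\<Sum>j\<in>{1..m} - {k}. \<alpha> j * inner x (p j y))"
    by (intro sum.cong refl) (simp add: orthogonal_projectionD(4)[OF p])
  then show ?thesis
    by (simp add: A_def inner_add_left inner_add_right inner_sum_left inner_sum_right
        orthogonal_projectionD(4)[OF P1] orthogonal_projectionD(4)[OF P2])
qed

lemma p_commutes_A:
  assumes j: "j \<in> {1..m} - {k}"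
  shows "p j (A x) = A (p j x)"
proof -
  have "p j (P1 x) = P1 (p j x) \<and> p j (P2 x) = P2 (p j x)"
    using j low high low' high' by (cases "j < k") auto
  moreover have "p j (p i x) = p i (p j x)" if "i \<in> {1..m} - {k}" for i
    using that j by (simp add: p_min min.commute)
  ultimately show ?thesis
    using p_linear[OF j] by (simp add: A_def linear_add linear_scale linear_sum)
qed

text \<open>A vector in a block between consecutive projections is fixed by those above and killed by the
others.\<close>

lemma level_sum:
  assumes "\<And>i. i \<in> {1..m} - {k} \<Longrightarrow> p i y = (if j < i then z else 0)"
  shows "(\<Sum>i\<in>{1..m} - {k}. \<alpha> i *\<^sub>R p i y) = (\<Sum>i\<in>{j<..m} - {k}. \<alpha> i) *\<^sub>R z"
proof -
  have "(\<Sum>i\<in>{1..m} - {k}. \<alpha> i *\<^sub>R p i y) = (\<Sum>i\<in>{1..m} - {k}. if j < i then \<alpha> i *\<^sub>R z else 0)"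
    by (intro sum.cong) (auto simp: assms)
  also have "\<dots> = (\<Sum>i\<in>{i \<in> {1..m} - {k}. j < i}. \<alpha> i *\<^sub>R z)" by (simp add: sum.If_cases Int_def)
  also have "{i \<in> {1..m} - {k}. j < i} = {j<..m} - {k}" by auto
  finally show ?thesis by (simp add: scaleR_sum_left)
qed

lemma c_eq: "c = (\<Sum>i\<in>{k<..m} - {k}. \<alpha> i)"
  unfolding c_def by (intro sum.cong) auto

lemma A_above_pair:
  assumes "\<And>i. i \<in> {1..m} - {k} \<Longrightarrow> p i y = (if j < i then y else 0)" "P1 y = 0" "P2 y = 0" "k < j"
  shows "A y = (\<Sum>i=j+1..m. \<alpha> i) *\<^sub>R y"
proof -
  have "{j<..m} - {k} = {j+1..m}" using assms(4) by auto
  then show ?thesis using level_sum[of y j y] assms by (simp add: A_def)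
qed

lemma A_below_pair:
  assumes "\<And>i. i \<in> {1..m} - {k} \<Longrightarrow> p i y = (if j < i then y else 0)" "P1 y = y" "P2 y = y" "j < k"
  shows "A y = ((\<Sum>i=j+1..k-1. \<alpha> i) + a1 + a2 + c) *\<^sub>R y"
proof -
  have "{j<..m} - {k} = {j+1..k-1} \<union> {k+1..m}" using assms(4) k by auto
  then have "(\<Sum>i\<in>{j<..m} - {k}. \<alpha> i) = (\<Sum>i=j+1..k-1. \<alpha> i) + c"
    unfolding c_def by (simp only:) (rule sum.union_disjoint, auto)
  then show ?thesis using level_sum[of y j y] assms by (simp add: A_def algebra_simps)
qed

lemma Suc_level: "k \<noteq> m \<Longrightarrow> Suc k \<in> {1..m} - {k}" using k by auto

lemma pred_level: "k \<noteq> 1 \<Longrightarrow> k - 1 \<in> {1..m} - {k}" using k by auto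

lemma upper_projection: "orthogonal_projection upper"
  using p[OF Suc_level] by (simp add: upper_def orthogonal_projection_id)

lemma lower_projection: "orthogonal_projection lower"
  using p[OF pred_level] by (simp add: lower_def orthogonal_projection_zero)

sublocale upper: bounded_linear upper by (rule orthogonal_projectionD(1)[OF upper_projection])
sublocale lower: bounded_linear lower by (rule orthogonal_projectionD(1)[OF lower_projection])

lemma upper_simps:
  shows "k < j \<Longrightarrow> j \<le> m \<Longrightarrow> p j (upper x) = upper x"
  and "1 \<le> j \<Longrightarrow> j < k \<Longrightarrow> p j (upper x) = p j x"
  and "P1 (upper x) = P1 x" "P2 (upper x) = P2 x" "upper (P1 x) = P1 x" "upper (P2 x) = P2 x"
  and "upper (A x) = A (upper x)"
proof -
  show "p j (upper x) = upper x" if "k < j" "j \<le> m"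
    using that p_min[of j "Suc k" x] Suc_level by (auto simp: upper_def min_absorb2)
  show "p j (upper x) = p j x" if "1 \<le> j" "j < k"
    using that k p_min[of j "Suc k" x] Suc_level by (auto simp: upper_def min_absorb1)
qed (use k high[of "Suc k"] high'[of "Suc k"] p_commutes_A[OF Suc_level] in \<open>auto simp: upper_def\<close>)

lemma lower_simps:
  shows "k < j \<Longrightarrow> j \<le> m \<Longrightarrow> p j (lower x) = lower x"
  and "1 \<le> j \<Longrightarrow> j < k \<Longrightarrow> p j (lower x) = p j x"
  and "P1 (lower x) = lower x" "P2 (lower x) = lower x" "lower (P1 x) = lower x" "lower (P2 x) = lower x"
  and "lower (A x) = A (lower x)"
proof -
  show "p j (lower x) = lower x" if "k < j" "j \<le> m"
    using that k p_min[of j "k - 1" x] pred_level p_linear[of j]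
    by (auto simp: lower_def min_absorb2 linear_0)
  show "p j (lower x) = p j x" if "1 \<le> j" "j < k"
    using that k p_min[of j "k - 1" x] pred_level by (auto simp: lower_def min_absorb1)
  show "lower (A x) = A (lower x)"
  proof (cases "k = 1")
    case True
    then have "lower = (\<lambda>x. 0)" unfolding lower_def by (rule if_P)
    then show ?thesis by (simp only: A.zero)
  next
    case False
    then have "lower = p (k - 1)" unfolding lower_def by (rule if_not_P)
    then show ?thesis by (simp only: p_commutes_A[OF pred_level[OF False]])
  qed
qed (use k low[of "k - 1"] low'[of "k - 1"] in \<open>auto simp: lower_def P1.zero P2.zero\<close>)

lemma upper_lower: "upper (lower x) = lower x" "lower (upper x) = lower x"
proof -
  show "upper (lower x) = lower x"
    using k lower_simps(1)[of "Suc k" x] by (auto simp: upper_def)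
  show "lower (upper x) = lower x"
    using k upper_simps(2)[of "k - 1" x] by (auto simp: lower_def)
qed

lemma upper_minus_lower_middle: "upper x - lower x \<in> middle"
  using orthogonal_projectionD(3)[OF upper_projection] orthogonal_projectionD(3)[OF lower_projection]
  by (simp add: middle_def upper.diff lower.diff upper_lower)

lemma middle_A: "x \<in> middle \<Longrightarrow> A x \<in> middle"
  by (simp add: middle_def upper_simps(7) lower_simps(7) A.zero)

lemma middle_subspace: "subspace middle"
  unfolding middle_def subspace_def
  by (simp add: upper.add lower.add upper.scaleR lower.scaleR upper.zero lower.zero)

text \<open>On the middle block all projections above the pair act as \<open>1\<close> and those below it as \<open>0\<close>, which leaves
the problem of two projections.\<close>

lemma A_middle:
  assumes x: "x \<in> middle"
  shows "A x = c *\<^sub>R x + a1 *\<^sub>R P1 x + a2 *\<^sub>R P2 x"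
proof -
  have "p i x = (if k < i then x else 0)" if i: "i \<in> {1..m} - {k}" for i
  proof (cases "k < i")
    case True
    then show ?thesis using upper_simps(1)[of i x] x i by (simp add: middle_def)
  next
    case False
    then have "i < k" "1 \<le> i" using i by auto
    then show ?thesis
      using lower_simps(2)[of i x] x i linear_0[OF p_linear[OF i]] by (simp add: middle_def)
  qed
  from level_sum[OF this] show ?thesis by (simp add: A_def c_eq)
qed

subsection \<open>The commutator of the incomparable projections\<close>

lemma K_bounded_linear: "bounded_linear K"
  unfolding K_def
  by (intro bounded_linear_intros bounded_linear_compose[OF P1.bounded_linear P2.bounded_linear]
      bounded_linear_compose[OF P2.bounded_linear P1.bounded_linear])

sublocale K: bounded_linear K by (rule K_bounded_linear)

lemma K_clinear: "bounded_clinear K"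
  unfolding bounded_clinear_def using K_bounded_linear
  by (simp add: K_def P1_simps P2_simps scaleC_diff_right scaleC_scaleR_commute)

lemma K_skew: "inner (K x) y = - inner x (K y)"
  by (simp add: K_def inner_diff_left inner_diff_right field_simps
      orthogonal_projectionD(4)[OF P1] orthogonal_projectionD(4)[OF P2])

lemma K_contraction: "norm (K x) \<le> norm x"
proof -
  have "norm (P1 (P2 x)) \<le> norm x" "norm (P2 (P1 x)) \<le> norm x"
    using order_trans[OF orthogonal_projection_norm_le[OF P1] orthogonal_projection_norm_le[OF P2]]
      order_trans[OF orthogonal_projection_norm_le[OF P2] orthogonal_projection_norm_le[OF P1]] by blast+
  then have "norm (P1 (P2 x) - P2 (P1 x)) \<le> 2 * norm x"
    using norm_triangle_ineq4[of "P1 (P2 x)" "P2 (P1 x)"] by linarith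
  then show ?thesis by (simp add: K_def)
qed

text \<open>For a projection \<open>P\<close> out of two, \<open>P C + C P = C\<close> holds for their commutator \<open>C\<close>. A projection above the
pair acts on \<open>C\<close> as \<open>1\<close> from both sides and contributes twice its weight to \<open>A C + C A\<close>; one below the
pair annihilates \<open>C\<close>. Hence \<open>A C + C A = s C\<close> on the whole space.\<close>

lemma K_reflects: "K (A x) = s *\<^sub>R K x - A (K x)"
proof -
  have pK: "p i (K x) = (if k < i then K x else 0)" if i: "i \<in> {1..m} - {k}" for i
    using i low high low' high'
    by (cases "k < i") (auto simp: K_def linear_scale[OF p_linear[OF i]] linear_diff[OF p_linear[OF i]])
  have Kp: "K (p i x) = (if k < i then K x else 0)" if i: "i \<in> {1..m} - {k}" for i
    using i low high low' high' by (cases "k < i") (auto simp: K_def)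
  have 1: "A (K x) = c *\<^sub>R K x + a1 *\<^sub>R P1 (K x) + a2 *\<^sub>R P2 (K x)"
    using level_sum[OF pK] by (simp add: A_def c_eq)
  have "K (\<Sum>i\<in>{1..m} - {k}. \<alpha> i *\<^sub>R p i x) = (\<Sum>i\<in>{1..m} - {k}. \<alpha> i *\<^sub>R K (p i x))"
    by (simp add: K.sum K.scaleR)
  also have "\<dots> = (\<Sum>i\<in>{1..m} - {k}. \<alpha> i *\<^sub>R p i (K x))"
    by (intro sum.cong refl) (simp only: pK Kp)
  also have "\<dots> = c *\<^sub>R K x" using level_sum[OF pK] by (simp add: c_eq)
  finally have 2: "K (A x) = c *\<^sub>R K x + a1 *\<^sub>R K (P1 x) + a2 *\<^sub>R K (P2 x)"
    by (simp add: A_def K.add K.scaleR)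
  have "P1 (K x) + K (P1 x) = K x" "P2 (K x) + K (P2 x) = K x"
    by (simp_all add: K_def P1.diff P2.diff P1.scaleR P2.scaleR P1_simps P2_simps
        flip: scaleR_add_right)
  then have "K (P1 x) = K x - P1 (K x)" "K (P2 x) = K x - P2 (K x)"
    by (simp_all add: eq_diff_eq add.commute)
  note KP = this
  show ?thesis unfolding 1 2 s_def KP
    by (rule inner_eqI) (simp add: inner_simps algebra_simps)
qed

lemma KK_commutes_A: "K (K (A x)) = A (K (K x))"
  by (simp add: K_reflects K.diff K.scaleR)

text \<open>\<open>T\<close> is the anticommutator \<open>R\<^sub>1 R\<^sub>2 + R\<^sub>2 R\<^sub>1\<close> of the reflections \<open>R\<^sub>i = 2 P\<^sub>i - 1\<close>. On the middle
block \<open>D = a\<^sub>1 R\<^sub>1 + a\<^sub>2 R\<^sub>2\<close>, so that \<open>D\<^sup>2\<close> is an affine function of \<open>T\<close>.\<close>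

definition T :: "'a \<Rightarrow> 'a" where
  "T x = 4 *\<^sub>R (P1 (P2 x) + P2 (P1 x)) - 4 *\<^sub>R (P1 x + P2 x) + 2 *\<^sub>R x"

definition D :: "'a \<Rightarrow> 'a" where "D x = 2 *\<^sub>R A x - s *\<^sub>R x"

lemma D_bounded_linear: "bounded_linear D"
  unfolding D_def by (intro bounded_linear_intros A.bounded_linear)

sublocale D: bounded_linear D by (rule D_bounded_linear)

lemma T_linear: "linear T"
  unfolding T_def
  by (rule linearI) (simp_all add: P1.add P2.add P1.scaleR P2.scaleR algebra_simps)

lemma T_norm_le: "norm (T x) \<le> 2 * norm x"
proof -
  let ?R1 = "\<lambda>x. 2 *\<^sub>R P1 x - x" and ?R2 = "\<lambda>x. 2 *\<^sub>R P2 x - x"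
  have "T x = ?R1 (?R2 x) + ?R2 (?R1 x)"
    by (rule inner_eqI) (simp add: T_def P1.diff P2.diff P1.scaleR P2.scaleR inner_simps algebra_simps)
  then show ?thesis
    using norm_triangle_ineq[of "?R1 (?R2 x)" "?R2 (?R1 x)"]
    by (simp add: orthogonal_projection_reflection_norm P1 P2)
qed

text \<open>\<open>8 K\<close> is the commutator of the two reflections, and for involutions the squares of commutator and
anticommutator differ by \<open>4\<close>.\<close>

lemma T_squared: "T (T x) = 4 *\<^sub>R x + 64 *\<^sub>R K (K x)"
  by (rule inner_eqI)
    (simp add: T_def K_def P1.diff P2.diff P1.scaleR P2.scaleR P1.add P2.add P1_simps P2_simps
      inner_simps algebra_simps)

lemma D_middle:
  assumes x: "x \<in> middle"
  shows "D x \<in> middle" "D (D x) = (a1\<^sup>2 + a2\<^sup>2) *\<^sub>R x + (a1 * a2) *\<^sub>R T x"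
proof -
  have D: "D x = a1 *\<^sub>R (2 *\<^sub>R P1 x - x) + a2 *\<^sub>R (2 *\<^sub>R P2 x - x)" if "x \<in> middle" for x
    by (rule inner_eqI) (simp add: D_def A_middle[OF that] s_def inner_simps algebra_simps)
  show Dx: "D x \<in> middle"
    using middle_subspace middle_A[OF x] x by (simp add: D_def subspace_diff subspace_scale)
  show "D (D x) = (a1\<^sup>2 + a2\<^sup>2) *\<^sub>R x + (a1 * a2) *\<^sub>R T x"
    unfolding D[OF Dx] unfolding D[OF x]
    by (rule inner_eqI)
      (simp add: T_def P1.diff P2.diff P1.scaleR P2.scaleR P1.add P2.add P1_simps P2_simps
        inner_simps algebra_simps power2_eq_square)
qed


subsection \<open>Location of the spectrum\<close>

text \<open>The component \<open>f x\<close> is bounded in terms of \<open>(A - z) x\<close>. If this holds for components that add up to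
\<open>x\<close>, then \<open>A - z\<close> is bounded below.\<close>

definition controlled :: "real \<Rightarrow> ('a \<Rightarrow> 'a) \<Rightarrow> bool" where
  "controlled z f \<longleftrightarrow> (\<exists>M. \<forall>x. norm (f x) \<le> M * norm (A x - z *\<^sub>R x))"

lemma controlled_add:
  assumes "controlled z f" "controlled z g" shows "controlled z (\<lambda>x. f x + g x)"
proof -
  obtain M N where "\<And>x. norm (f x) \<le> M * norm (A x - z *\<^sub>R x)" "\<And>x. norm (g x) \<le> N * norm (A x - z *\<^sub>R x)"
    using assms unfolding controlled_def by blast
  then have "norm (f x + g x) \<le> (M + N) * norm (A x - z *\<^sub>R x)" for x
    by (metis norm_triangle_mono distrib_right)
  then show ?thesis unfolding controlled_def by blast
qed

lemma controlled_commuting: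
  assumes f: "bounded_linear f" "\<And>x. f (A x) = A (f x)"
    and d: "d > 0" "\<And>x. d * norm (f x) \<le> norm (A (f x) - z *\<^sub>R f x)"
  shows "controlled z f"
proof -
  interpret f: bounded_linear f by (rule f(1))
  obtain M where M: "\<And>x. norm (f x) \<le> norm x * M" using f.bounded by blast
  have "d * norm (f x) \<le> M * norm (A x - z *\<^sub>R x)" for x
    using d(2)[of x] M[of "A x - z *\<^sub>R x"] by (simp add: f.diff f.scaleR f(2) mult.commute)
  then have "norm (f x) \<le> M / d * norm (A x - z *\<^sub>R x)" for x
    using d(1) by (simp add: field_simps)
  then show ?thesis unfolding controlled_def by blast
qed

lemma controlled_eigen:
  assumes "bounded_linear f" "\<And>x. f (A x) = A (f x)" "\<And>x. A (f x) = d *\<^sub>R f x" "d \<noteq> z"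
  shows "controlled z f"
  by (rule controlled_commuting[where d = "\<bar>d - z\<bar>"])
    (use assms in \<open>simp_all flip: scaleR_diff_left\<close>)

lemma in_Delta_d:
  "k < i \<Longrightarrow> i \<le> m + 1 \<Longrightarrow> (\<Sum>j=i..m. \<alpha> j) \<in> Delta_d m k \<alpha> a1 a2"
  "c + a1 \<in> Delta_d m k \<alpha> a1 a2" "c + a2 \<in> Delta_d m k \<alpha> a1 a2"
  "1 \<le> i \<Longrightarrow> i \<le> k \<Longrightarrow> (\<Sum>j=i..k-1. \<alpha> j) + a1 + a2 + c \<in> Delta_d m k \<alpha> a1 a2"
proof -
  show "(\<Sum>j=i..m. \<alpha> j) \<in> Delta_d m k \<alpha> a1 a2" if "k < i" "i \<le> m + 1"
  proof (cases "i = m + 1")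
    case True
    then show ?thesis by (simp add: Delta_d_def)
  next
    case False
    then have "k + 1 \<le> i \<and> i \<le> m" using that by simp
    then show ?thesis unfolding Delta_d_def by blast
  qed
  show "c + a1 \<in> Delta_d m k \<alpha> a1 a2" "c + a2 \<in> Delta_d m k \<alpha> a1 a2"
    by (simp_all add: Delta_d_def c_def add.commute)
  show "(\<Sum>j=i..k-1. \<alpha> j) + a1 + a2 + c \<in> Delta_d m k \<alpha> a1 a2" if "1 \<le> i" "i \<le> k"
  proof (cases "i = k")
    case True
    then have "(\<Sum>j=i..k-1. \<alpha> j) = 0" using k by simp
    then show ?thesis by (simp add: Delta_d_def c_def)
  next
    case False
    then have "1 \<le> i \<and> i \<le> k - 1" using that by simp
    then show ?thesis unfolding Delta_d_def c_def by blast
  qed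
qed

text \<open>The orthogonal complement of the range of \<open>upper\<close> is a sum of blocks on which \<open>A\<close> is a scalar from the discrete
set; they are added one at a time, starting from the top.\<close>

lemma controlled_above_pair:
  assumes z: "z \<notin> Delta_d m k \<alpha> a1 a2"
  shows "controlled z (\<lambda>x. x - upper x)"
proof -
  have block: "controlled z f"
    if f: "bounded_linear f" "\<And>x. f (A x) = A (f x)" and j: "k < j" "j \<le> m"
      and lev: "\<And>i x. i \<in> {1..m} - {k} \<Longrightarrow> p i (f x) = (if j < i then f x else 0)"
        "\<And>x. P1 (f x) = 0" "\<And>x. P2 (f x) = 0" for f j
  proof (rule controlled_eigen[OF f])
    show "A (f x) = (\<Sum>i=j+1..m. \<alpha> i) *\<^sub>R f x" for x
      using A_above_pair[of "f x" j] lev j by blast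
    show "(\<Sum>i=j+1..m. \<alpha> i) \<noteq> z" using in_Delta_d(1)[of "j + 1"] j z by auto
  qed
  have bl: "bounded_linear (p j)" if "k < j" "j \<le> m" for j
    using that orthogonal_projectionD(1)[OF p] k by simp
  have main: "controlled z (\<lambda>x. x - p j x)" if "k < j" "j \<le> m" for j
    using that(2,1)
  proof (induction j rule: inc_induct)
    case base
    then have m: "m \<in> {1..m} - {k}" using k by simp
    show ?case
    proof (rule block[of _ m])
      show "p i (x - p m x) = (if m < i then x - p m x else 0)" if "i \<in> {1..m} - {k}" for i x
        using that p_min[OF that m, of x] by (simp add: linear_diff[OF p_linear] min_absorb1)
    qed (use base bl[of m] p_commutes_A[OF m] high in
      \<open>simp_all add: bounded_linear_sub A.diff P1.diff P2.diff\<close>)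
  next
    case (step n)
    then have n: "n \<in> {1..m} - {k}" "Suc n \<in> {1..m} - {k}" by auto
    have "controlled z (\<lambda>x. p (Suc n) x - p n x)"
    proof (rule block[of _ n])
      show "p i (p (Suc n) x - p n x) = (if n < i then p (Suc n) x - p n x else 0)"
        if "i \<in> {1..m} - {k}" for i x
        using that p_min[OF that n(1), of x] p_min[OF that n(2), of x]
        by (cases "n < i") (simp_all add: linear_diff[OF p_linear] min_absorb1 min_absorb2)
    qed (use step bl[of n] bl[of "Suc n"] p_commutes_A[OF n(1)] p_commutes_A[OF n(2)] high in
      \<open>simp_all add: bounded_linear_sub A.diff P1.diff P2.diff\<close>)
    from controlled_add[OF step.IH this] step.prems show ?case by simp
  qed
  show ?thesis
  proof (cases "k = m")
    case True
    then have "upper = (\<lambda>x. x)" unfolding upper_def by (rule if_P)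
    then show ?thesis by (auto simp: controlled_def intro!: exI[of _ 0])
  next
    case False
    then show ?thesis using main[of "k + 1"] k by (simp add: upper_def)
  qed
qed

lemma controlled_below_pair:
  assumes z: "z \<notin> Delta_d m k \<alpha> a1 a2"
  shows "controlled z lower"
proof -
  have block: "controlled z f"
    if f: "bounded_linear f" "\<And>x. f (A x) = A (f x)" and j: "j < k"
      and lev: "\<And>i x. i \<in> {1..m} - {k} \<Longrightarrow> p i (f x) = (if j < i then f x else 0)"
        "\<And>x. P1 (f x) = f x" "\<And>x. P2 (f x) = f x" for f j
  proof (rule controlled_eigen[OF f])
    show "A (f x) = ((\<Sum>i=j+1..k-1. \<alpha> i) + a1 + a2 + c) *\<^sub>R f x" for x
      using A_below_pair[of "f x" j] lev j by blast
    show "(\<Sum>i=j+1..k-1. \<alpha> i) + a1 + a2 + c \<noteq> z" using in_Delta_d(4)[of "j + 1"] j z by auto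
  qed
  have bl: "bounded_linear (p j)" if "1 \<le> j" "j < k" for j
    using that orthogonal_projectionD(1)[OF p] k by simp
  have main: "controlled z (p j)" if "1 \<le> j" "j < k" for j
    using that
  proof (induction j rule: dec_induct)
    case base
    then have 1: "1 \<in> {1..m} - {k}" using k by simp
    show ?case
    proof (rule block[of _ 0])
      show "p i (p 1 x) = (if 0 < i then p 1 x else 0)" if "i \<in> {1..m} - {k}" for i x
        using that p_min[OF that 1, of x] by (simp add: min_absorb2)
    qed (use base bl[of 1] p_commutes_A[OF 1] low' in simp_all)
  next
    case (step n)
    then have n: "n \<in> {1..m} - {k}" "Suc n \<in> {1..m} - {k}" using k by auto
    have "controlled z (\<lambda>x. p (Suc n) x - p n x)"
    proof (rule block[of _ n])
      show "p i (p (Suc n) x - p n x) = (if n < i then p (Suc n) x - p n x else 0)"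
        if "i \<in> {1..m} - {k}" for i x
        using that p_min[OF that n(1), of x] p_min[OF that n(2), of x]
        by (cases "n < i") (simp_all add: linear_diff[OF p_linear] min_absorb1 min_absorb2)
    qed (use step bl[of n] bl[of "Suc n"] p_commutes_A[OF n(1)] p_commutes_A[OF n(2)] low' in
      \<open>simp_all add: bounded_linear_sub A.diff P1.diff P2.diff\<close>)
    from controlled_add[OF this step.IH] step.prems show ?case by simp
  qed
  show ?thesis
  proof (cases "k = 1")
    case True
    then have "lower = (\<lambda>x. 0)" unfolding lower_def by (rule if_P)
    then show ?thesis by (auto simp: controlled_def intro!: exI[of _ 0])
  next
    case False
    then show ?thesis using main[of "k - 1"] k unfolding lower_def by simp
  qed
qed

text \<open>With \<open>w = 2 z - s\<close>, on the middle block \<open>(D + w) (D - w) = a\<^sub>1\<^sup>2 + a\<^sub>2\<^sup>2 - w\<^sup>2 + a\<^sub>1 a\<^sub>2 T\<close>, and \<open>T\<close> has norm at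
most \<open>2\<close>. The product is bounded below as soon as \<open>w\<^sup>2\<close> lies outside the interval from
\<open>(a\<^sub>1 - a\<^sub>2)\<^sup>2\<close> to \<open>(a\<^sub>1 + a\<^sub>2)\<^sup>2\<close>, and then so is \<open>D - w = 2 (A - z)\<close>.\<close>

lemma controlled_middle:
  assumes z: "\<bar>2 * z - s\<bar> < \<bar>a1 - a2\<bar> \<or> a1 + a2 < \<bar>2 * z - s\<bar>"
  shows "controlled z (\<lambda>x. upper x - lower x)"
proof -
  define w where "w = 2 * z - s"
  define \<delta> where "\<delta> = \<bar>w\<^sup>2 - a1\<^sup>2 - a2\<^sup>2\<bar> - 2 * a1 * a2"
  have "w\<^sup>2 < (a1 - a2)\<^sup>2 \<or> (a1 + a2)\<^sup>2 < w\<^sup>2"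
    using z a1 a2 power_strict_mono[of "\<bar>w\<bar>" "\<bar>a1 - a2\<bar>" 2] power_strict_mono[of "a1 + a2" "\<bar>w\<bar>" 2]
    by (auto simp: w_def)
  then have \<delta>: "\<delta> > 0" using a1 a2 by (auto simp: \<delta>_def power2_eq_square algebra_simps)
  have "bounded_linear (\<lambda>x. D x + w *\<^sub>R x)" by (intro bounded_linear_intros D.bounded_linear)
  then obtain M where M: "M > 0" "\<And>x. norm (D x + w *\<^sub>R x) \<le> norm x * M"
    using bounded_linear.pos_bounded by blast
  have low: "\<delta> * norm y \<le> (2 * M) * norm (A y - z *\<^sub>R y)" if y: "y \<in> middle" for y
  proof -
    define v where "v = D y - w *\<^sub>R y"
    have v: "v = 2 *\<^sub>R (A y - z *\<^sub>R y)"
      by (simp add: v_def D_def w_def algebra_simps)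
    have "D v + w *\<^sub>R v = (a1 * a2) *\<^sub>R T y - (w\<^sup>2 - a1\<^sup>2 - a2\<^sup>2) *\<^sub>R y"
      by (simp add: v_def D.diff D.scaleR D_middle(2)[OF y] algebra_simps power2_eq_square)
    then have "norm ((w\<^sup>2 - a1\<^sup>2 - a2\<^sup>2) *\<^sub>R y) - norm ((a1 * a2) *\<^sub>R T y) \<le> norm (D v + w *\<^sub>R v)"
      by (metis norm_triangle_ineq2 norm_minus_commute)
    then have "\<bar>w\<^sup>2 - a1\<^sup>2 - a2\<^sup>2\<bar> * norm y - norm ((a1 * a2) *\<^sub>R T y) \<le> norm (D v + w *\<^sub>R v)"
      by (simp only: norm_scaleR)
    moreover have "norm ((a1 * a2) *\<^sub>R T y) \<le> (a1 * a2) * (2 * norm y)"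
      using a1 a2 T_norm_le[of y] by (simp add: abs_mult mult_left_mono)
    ultimately have "\<delta> * norm y \<le> norm (D v + w *\<^sub>R v)"
      unfolding \<delta>_def left_diff_distrib by linarith
    also have "\<dots> \<le> norm v * M" by (rule M(2))
    finally show ?thesis unfolding v by (simp add: mult_ac)
  qed
  show ?thesis
  proof (rule controlled_commuting[where d = "\<delta> / (2 * M)"])
    show "\<delta> / (2 * M) * norm (upper x - lower x)
        \<le> norm (A (upper x - lower x) - z *\<^sub>R (upper x - lower x))" for x
      using low[OF upper_minus_lower_middle, of x] M(1) by (simp add: field_simps)
  qed (use \<delta> M(1) in \<open>simp_all add: bounded_linear_sub upper.bounded_linear lower.bounded_linear
      upper_simps lower_simps A.diff\<close>)
qed

text \<open>The four end points \<open>\<plusminus> (a\<^sub>1 + a\<^sub>2)\<close>, \<open>\<plusminus> (a\<^sub>1 - a\<^sub>2)\<close> of the values of \<open>2 z - s\<close> where the estimate on the middle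
block fails correspond to
\<open>a\<^sub>1 + a\<^sub>2 + c\<close>, \<open>c\<close>, \<open>c + a\<^sub>1\<close> and \<open>c + a\<^sub>2\<close>, which belong to the discrete set.\<close>

lemma outside_Delta:
  assumes z: "z \<notin> Delta_d m k \<alpha> a1 a2" "z \<notin> Delta_c_plus s a1 a2" "z \<notin> Delta_c_minus s a1 a2"
  shows "\<bar>2 * z - s\<bar> < \<bar>a1 - a2\<bar> \<or> a1 + a2 < \<bar>2 * z - s\<bar>"
proof (rule ccontr)
  define l where "l = \<bar>2 * z - s\<bar>"
  assume "\<not> ?thesis"
  then have l: "\<bar>a1 - a2\<bar> \<le> l" "l \<le> a1 + a2" by (auto simp: l_def)
  have zl: "z = (s + l) / 2 \<or> z = (s - l) / 2" by (auto simp: l_def)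
  have "\<not> (\<bar>a1 - a2\<bar> < l \<and> l < a1 + a2)"
    using z zl unfolding Delta_c_plus_def Delta_c_minus_def by blast
  then have "l = \<bar>a1 - a2\<bar> \<or> l = a1 + a2" using l by linarith
  then have "z = c \<or> z = c + a1 \<or> z = c + a2 \<or> z = a1 + a2 + c"
    using zl unfolding s_def by (auto simp: abs_if split: if_splits)
  moreover have "c \<in> Delta_d m k \<alpha> a1 a2" using in_Delta_d(1)[of "k + 1"] k by (simp add: c_def)
  moreover have "a1 + a2 + c \<in> Delta_d m k \<alpha> a1 a2" using in_Delta_d(4)[of k] k by simp
  ultimately show False using z in_Delta_d by auto
qed

lemma spectrum_A:
  "spectrum A \<subseteq> complex_of_real ` (Delta_d m k \<alpha> a1 a2 \<union> Delta_c_plus s a1 a2 \<union> Delta_c_minus s a1 a2)"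
proof
  fix \<zeta> assume \<zeta>: "\<zeta> \<in> spectrum A"
  define z where "z = Re \<zeta>"
  have \<zeta>z: "\<zeta> = complex_of_real z"
    using symmetric_spectrum_real[OF A_clinear A_sym \<zeta>] by (simp add: z_def complex_eq_iff)
  have "z \<in> Delta_d m k \<alpha> a1 a2 \<union> Delta_c_plus s a1 a2 \<union> Delta_c_minus s a1 a2"
  proof (rule ccontr)
    assume out: "\<not> ?thesis"
    have "controlled z (\<lambda>x. (x - upper x) + ((upper x - lower x) + lower x))"
      using out outside_Delta[of z]
      by (intro controlled_add controlled_above_pair controlled_middle controlled_below_pair) auto
    then obtain M where M: "\<And>x. norm x \<le> M * norm (A x - z *\<^sub>R x)"
      unfolding controlled_def by auto
    have "1 / max M 1 * norm x \<le> norm (A x - z *\<^sub>R x)" for x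
    proof -
      have "norm x \<le> max M 1 * norm (A x - z *\<^sub>R x)"
        using M[of x] by (rule order_trans) (simp add: mult_right_mono)
      then show ?thesis by (simp add: field_simps)
    qed
    then have "complex_of_real z \<notin> spectrum A"
      by (intro bounded_below_not_in_spectrum[OF A_clinear A_sym, of "1 / max M 1"]) auto
    then show False using \<zeta> \<zeta>z by simp
  qed
  then show "\<zeta> \<in> complex_of_real ` (Delta_d m k \<alpha> a1 a2 \<union> Delta_c_plus s a1 a2 \<union> Delta_c_minus s a1 a2)"
    using \<zeta>z by blast
qed

subsection \<open>Localisation in the middle block\<close>

lemma form_above_pair:
  assumes y: "upper y = 0"
  shows "inner y (A y) \<le> c * (norm y)\<^sup>2"
proof -
  have P0: "P1 y = 0" "P2 y = 0" using upper_simps(3,4)[of y] y by (auto simp: P1.zero P2.zero)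
  have "inner y (p i y) \<le> (if k < i then (norm y)\<^sup>2 else 0)" if i: "i \<in> {1..m} - {k}" for i
  proof (cases "k < i")
    case True
    then show ?thesis
      using orthogonal_projection_pythagoras(1)[OF p[OF i], of y]
        power_mono[OF orthogonal_projection_norm_le[OF p[OF i]], of y 2] by simp
  next
    case False
    then show ?thesis
      using i upper_simps(2)[of i y] y linear_0[OF p_linear[OF i]] by auto
  qed
  then have "(\<Sum>i\<in>{1..m} - {k}. \<alpha> i * inner y (p i y)) \<le> (\<Sum>i\<in>{1..m} - {k}. \<alpha> i * (if k < i then (norm y)\<^sup>2 else 0))"
    using \<alpha> by (intro sum_mono mult_left_mono) (auto intro: less_imp_le)
  also have "\<dots> = (\<Sum>i\<in>{1..m} - {k}. if k < i then \<alpha> i * (norm y)\<^sup>2 else 0)"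
    by (intro sum.cong) auto
  also have "\<dots> = (\<Sum>i\<in>{i \<in> {1..m} - {k}. k < i}. \<alpha> i * (norm y)\<^sup>2)" by (simp add: sum.If_cases Int_def)
  also have "{i \<in> {1..m} - {k}. k < i} = {k<..m} - {k}" by auto
  finally show ?thesis
    by (simp add: A_def P0 inner_sum_right c_eq sum_distrib_right)
qed

lemma form_below_pair:
  assumes y: "lower y = y"
  shows "(c + a1 + a2) * (norm y)\<^sup>2 \<le> inner y (A y)"
proof -
  have Py: "P1 y = y" "P2 y = y" using lower_simps(3,4)[of y] y by auto
  have "(if k < i then (norm y)\<^sup>2 else 0) \<le> inner y (p i y)" if i: "i \<in> {1..m} - {k}" for i
  proof (cases "k < i")
    case True
    then show ?thesis
      using lower_simps(1)[of i y] y i by (simp add: power2_norm_eq_inner)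
  next
    case False
    then show ?thesis
      using orthogonal_projection_pythagoras(1)[OF p[OF i], of y] zero_le_power2[of "norm (p i y)"]
      by (simp del: zero_le_power2)
  qed
  then have "(\<Sum>i\<in>{1..m} - {k}. \<alpha> i * (if k < i then (norm y)\<^sup>2 else 0)) \<le> (\<Sum>i\<in>{1..m} - {k}. \<alpha> i * inner y (p i y))"
    using \<alpha> by (intro sum_mono mult_left_mono) (auto intro: less_imp_le)
  moreover have "(\<Sum>i\<in>{1..m} - {k}. \<alpha> i * (if k < i then (norm y)\<^sup>2 else 0)) = c * (norm y)\<^sup>2"
  proof -
    have "(\<Sum>i\<in>{1..m} - {k}. \<alpha> i * (if k < i then (norm y)\<^sup>2 else 0))
        = (\<Sum>i\<in>{1..m} - {k}. if k < i then \<alpha> i * (norm y)\<^sup>2 else 0)"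
      by (intro sum.cong) auto
    also have "\<dots> = (\<Sum>i\<in>{i \<in> {1..m} - {k}. k < i}. \<alpha> i * (norm y)\<^sup>2)" by (simp add: sum.If_cases Int_def)
    also have "{i \<in> {1..m} - {k}. k < i} = {k<..m} - {k}" by auto
    finally show ?thesis by (simp add: c_eq sum_distrib_right)
  qed
  ultimately show ?thesis
    by (simp add: A_def Py inner_sum_right inner_add_right power2_norm_eq_inner algebra_simps)
qed

text \<open>The form of \<open>A\<close> is at most \<open>c\<close> on the kernel of \<open>upper\<close> and at least
\<open>c + a\<^sub>1 + a\<^sub>2\<close> on the range of \<open>lower\<close>. This serves both eigenspaces and spectral subspaces.\<close>

lemma middle_if_form_between:
  assumes V: "\<And>y. y \<in> V \<Longrightarrow> y - upper y \<in> V" "\<And>y. y \<in> V \<Longrightarrow> lower y \<in> V"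
    and ge: "\<And>y. y \<in> V \<Longrightarrow> a * (norm y)\<^sup>2 \<le> inner y (A y)" "c < a"
    and le: "\<And>y. y \<in> V \<Longrightarrow> inner y (A y) \<le> b * (norm y)\<^sup>2" "b < c + a1 + a2"
    and x: "x \<in> V"
  shows "x \<in> middle"
proof -
  let ?y = "x - upper x"
  have "upper ?y = 0" by (simp add: upper.diff orthogonal_projectionD(3)[OF upper_projection])
  from form_above_pair[OF this] ge(1)[OF V(1)[OF x]] have "(a - c) * (norm ?y)\<^sup>2 \<le> 0"
    by (simp add: left_diff_distrib)
  then have "upper x = x" using ge(2) by (simp add: mult_le_0_iff)
  have "lower (lower x) = lower x" by (rule orthogonal_projectionD(3)[OF lower_projection])
  from form_below_pair[OF this] le(1)[OF V(2)[OF x]] have "(c + a1 + a2 - b) * (norm (lower x))\<^sup>2 \<le> 0"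
    by (simp add: left_diff_distrib)
  then have "lower x = 0" using le(2) by (simp add: mult_le_0_iff)
  with \<open>upper x = x\<close> show ?thesis by (simp add: middle_def)
qed

subsection \<open>Eigenvalues\<close>

text \<open>On the eigenspace \<open>D\<close> is the scalar \<open>2 z - s\<close>, so \<open>T\<close> and \<open>K\<^sup>2\<close> are scalars too. The value of \<open>\<kappa>\<close> is
recorded because it depends only on \<open>(2 z - s)\<^sup>2\<close> and is therefore shared by \<open>z\<close> and \<open>s - z\<close>.\<close>

lemma KK_on_eigenspace:
  assumes w: "\<bar>a1 - a2\<bar> < \<bar>2 * z - s\<bar>" "\<bar>2 * z - s\<bar> < a1 + a2"
  obtains \<kappa> where "\<kappa> > 0" "\<And>x. A x = z *\<^sub>R x \<Longrightarrow> K (K x) = - (\<kappa> *\<^sub>R x)" 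
    "\<kappa> = (4 - ((((2 * z - s)\<^sup>2 - a1\<^sup>2 - a2\<^sup>2) / (a1 * a2)))\<^sup>2) / 64"
proof -
  define \<tau> where "\<tau> = ((2 * z - s)\<^sup>2 - a1\<^sup>2 - a2\<^sup>2) / (a1 * a2)"
  have "(a1 - a2)\<^sup>2 < (2 * z - s)\<^sup>2" "(2 * z - s)\<^sup>2 < (a1 + a2)\<^sup>2"
    using w power_strict_mono[of "\<bar>a1 - a2\<bar>" "\<bar>2 * z - s\<bar>" 2] power_strict_mono[of "\<bar>2 * z - s\<bar>" "a1 + a2" 2]
    by auto
  then have "\<bar>\<tau>\<bar> < 2"
    using a1 a2 by (simp add: \<tau>_def abs_less_iff field_simps power2_eq_square)
  then have "\<tau>\<^sup>2 < 4" using abs_square_less_1[of "\<tau> / 2"] by (simp add: power_divide)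
  moreover have "K (K x) = - (((4 - \<tau>\<^sup>2) / 64) *\<^sub>R x)" if x: "A x = z *\<^sub>R x" for x
  proof -
    have "c < z" "z < c + a1 + a2" using w unfolding s_def by (auto simp: abs_less_iff)
    then have mid: "x \<in> middle"
      using x by (intro middle_if_form_between[of "{x. A x = z *\<^sub>R x}" z z])
        (auto simp: power2_norm_eq_inner A.diff upper.scaleR lower.scaleR algebra_simps
          simp flip: upper_simps(7) lower_simps(7))
    have D: "D x = (2 * z - s) *\<^sub>R x" by (simp add: D_def x algebra_simps)
    have "(a1\<^sup>2 + a2\<^sup>2) *\<^sub>R x + (a1 * a2) *\<^sub>R T x = (2 * z - s)\<^sup>2 *\<^sub>R x"
      using D_middle(2)[OF mid] D by (simp add: D.scaleR power2_eq_square)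
    then have "(a1 * a2) *\<^sub>R T x = (2 * z - s)\<^sup>2 *\<^sub>R x - (a1\<^sup>2 + a2\<^sup>2) *\<^sub>R x"
      by (metis add_diff_cancel_left')
    also have "\<dots> = (a1 * a2) *\<^sub>R (\<tau> *\<^sub>R x)"
      using a1 a2 by (simp add: \<tau>_def diff_diff_eq flip: scaleR_diff_left)
    finally have T: "T x = \<tau> *\<^sub>R x" using a1 a2 by (simp only: scaleR_cancel_left) auto
    have "4 *\<^sub>R x + 64 *\<^sub>R K (K x) = \<tau>\<^sup>2 *\<^sub>R x"
      using T_squared[of x] T linear_scale[OF T_linear] by (simp add: power2_eq_square)
    then have "64 *\<^sub>R K (K x) = (\<tau>\<^sup>2 - 4) *\<^sub>R x" by (simp add: algebra_simps eq_diff_eq)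
    then have "(1/64) *\<^sub>R 64 *\<^sub>R K (K x) = (1/64) *\<^sub>R (\<tau>\<^sup>2 - 4) *\<^sub>R x" by simp
    then show ?thesis by (simp add: diff_divide_distrib scaleR_diff_left scaleR_diff_right)
  qed
  ultimately show ?thesis using that[of "(4 - \<tau>\<^sup>2) / 64"] by (simp add: \<tau>_def)
qed

text \<open>Between these eigenspaces \<open>K\<close> is already a multiple of a unitary map.\<close>

lemma eigenvectors_reflect:
  assumes w: "\<bar>a1 - a2\<bar> < \<bar>2 * z - s\<bar>" "\<bar>2 * z - s\<bar> < a1 + a2"
  shows "eigenvalue A (complex_of_real z) \<longleftrightarrow> eigenvalue A (complex_of_real (s - z))"
    and "same_multiplicity A (complex_of_real z) (complex_of_real (s - z))"
proof -
  let ?V = "{x. A x = z *\<^sub>R x}" and ?W = "{x. A x = (s - z) *\<^sub>R x}"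
  have w': "\<bar>a1 - a2\<bar> < \<bar>2 * (s - z) - s\<bar>" "\<bar>2 * (s - z) - s\<bar> < a1 + a2"
    using w by auto
  have sq: "(2 * (s - z) - s)\<^sup>2 = (2 * z - s)\<^sup>2" by (simp add: power2_eq_square algebra_simps)
  obtain \<kappa> where \<kappa>: "\<kappa> > 0" "\<And>x. x \<in> ?V \<Longrightarrow> K (K x) = - (\<kappa> *\<^sub>R x)"
    and "\<kappa> = (4 - ((((2 * z - s)\<^sup>2 - a1\<^sup>2 - a2\<^sup>2) / (a1 * a2)))\<^sup>2) / 64"
    using KK_on_eigenspace[OF w] by blast
  then have \<kappa>': "\<And>x. x \<in> ?W \<Longrightarrow> K (K x) = - (\<kappa> *\<^sub>R x)"
    using KK_on_eigenspace[OF w'] unfolding sq by blast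
  have AK: "A (K x) = s *\<^sub>R K x - K (A x)" for x by (simp add: K_reflects)
  have VW: "K x \<in> ?W" if "x \<in> ?V" for x
    using that by (simp add: AK K.scaleR K.diff scaleR_diff_left)
  have WV: "K x \<in> ?V" if "x \<in> ?W" for x
    using that by (simp add: AK K.scaleR K.diff scaleR_diff_left)
  define U where "U x = (1 / sqrt \<kappa>) *\<^sub>R K x" for x
  have UV: "U ` ?V = ?W"
  proof (intro subset_antisym subsetI)
    fix y assume y: "y \<in> ?W"
    have "U (- U y) = y"
      using \<kappa>'[OF y] \<kappa>(1) by (simp add: U_def K.scaleR K.neg)
    moreover have "- U y \<in> ?V" using WV[OF y] by (simp add: U_def A.scaleR A.neg scaleR_left_commute)
    ultimately show "y \<in> U ` ?V" by (metis image_eqI)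
  qed (use VW in \<open>auto simp: U_def A.scaleR scaleR_left_commute\<close>)
  have Uinner: "inner (U x) (U y) = inner x y" if "y \<in> ?V" for x y
    using \<kappa>(1) \<kappa>(2)[OF that] by (simp add: U_def K_skew)
  have V: "i *\<^sub>C x \<in> ?V" if "x \<in> ?V" for i x
    using that by (simp add: bounded_clinearD(2)[OF A_clinear] scaleC_scaleR_commute)
  have Uc: "U (i *\<^sub>C x) = i *\<^sub>C U x" for i x
    by (simp add: U_def bounded_clinearD(2)[OF K_clinear] scaleC_scaleR_commute)
  have "same_dimension ?V ?W"
  proof (rule same_dimension_if_unitary[OF V UV])
    show "cinner (U x) (U y) = cinner x y" if "x \<in> ?V" "y \<in> ?V" for x y
      unfolding cinner_from_inner Uc[symmetric] Uinner[OF that(2)] Uinner[OF V[OF that(2)]] ..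
  qed
  then show "same_multiplicity A (complex_of_real z) (complex_of_real (s - z))"
    unfolding same_multiplicity_def eigenspace_def scaleC_of_real .
  have U0: "U x = 0 \<longleftrightarrow> x = 0" if "x \<in> ?V" for x
    using Uinner[OF that, of x] by (metis inner_eq_zero_iff)
  have "(\<exists>x. x \<noteq> 0 \<and> x \<in> ?V) \<longleftrightarrow> (\<exists>y. y \<noteq> 0 \<and> y \<in> ?W)"
    unfolding UV[symmetric] using U0 by blast
  then show "eigenvalue A (complex_of_real z) \<longleftrightarrow> eigenvalue A (complex_of_real (s - z))"
    unfolding eigenvalue_def scaleC_of_real by simp
qed


subsection \<open>The unitary equivalence\<close>

text \<open>\<open>64 a\<^sub>1\<^sup>2 a\<^sub>2\<^sup>2 K\<^sup>2 = a\<^sub>1\<^sup>2 a\<^sub>2\<^sup>2 (T\<^sup>2 - 4)\<close> is a product of four linear factors in \<open>D\<close>, whose zeros correspond to the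
end points of the two spectral intervals.\<close>

lemma KK_factorization:
  assumes x: "x \<in> middle" and S: "\<And>w y. S w y = D y - w *\<^sub>R y"
  shows "(64 * a1\<^sup>2 * a2\<^sup>2) *\<^sub>R K (K x)
    = S (a1 + a2) (S (- (a1 + a2)) (S (a1 - a2) (S (- (a1 - a2)) x)))"
proof -
  have quad: "D (D y + r *\<^sub>R y) - r *\<^sub>R (D y + r *\<^sub>R y) = (a1\<^sup>2 + a2\<^sup>2 - r\<^sup>2) *\<^sub>R y + (a1 * a2) *\<^sub>R T y"
    if "y \<in> middle" for y r
    by (simp add: D.add D.scaleR D_middle(2)[OF that] algebra_simps power2_eq_square)
  define y where "y = D (D x + (a1 - a2) *\<^sub>R x) - (a1 - a2) *\<^sub>R (D x + (a1 - a2) *\<^sub>R x)"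
  have "y \<in> middle"
    using middle_subspace D_middle(1) x unfolding y_def
    by (simp add: subspace_diff subspace_add subspace_scale)
  have y: "y = (a1 * a2) *\<^sub>R (T x + 2 *\<^sub>R x)"
    unfolding y_def quad[OF x]
    by (rule inner_eqI) (simp add: inner_simps algebra_simps power2_eq_square)
  have Ty: "T y = (a1 * a2) *\<^sub>R (4 *\<^sub>R x + 64 *\<^sub>R K (K x) + 2 *\<^sub>R T x)"
    unfolding y by (simp add: linear_scale[OF T_linear] linear_add[OF T_linear] T_squared)
  have "(64 * a1\<^sup>2 * a2\<^sup>2) *\<^sub>R K (K x) = (a1\<^sup>2 + a2\<^sup>2 - (a1 + a2)\<^sup>2) *\<^sub>R y + (a1 * a2) *\<^sub>R T y"
    unfolding Ty unfolding y by (rule inner_eqI) (simp add: inner_simps algebra_simps power2_eq_square)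
  also have "\<dots> = D (D y + (a1 + a2) *\<^sub>R y) - (a1 + a2) *\<^sub>R (D y + (a1 + a2) *\<^sub>R y)"
    by (rule quad[OF \<open>y \<in> middle\<close>, symmetric])
  finally show ?thesis unfolding S scaleR_minus_left diff_minus_eq_add by (simp only: y_def)
qed

text \<open>Since \<open>K\<close> is skew, \<open>- K\<^sup>2\<close> is positive; its root \<open>W\<close> plays the role of the absolute value of \<open>K\<close>.\<close>

lemma commutator_root:
  obtains W where "bounded_clinear W" "\<And>x y. inner (W x) y = inner x (W y)"
    "\<And>x. W (W x) = - K (K x)" "\<And>x. W (A x) = A (W x)"
proof -
  define Y where "Y x = x + K (K x)" for x
  have KK: "bounded_linear (\<lambda>x. K (K x))" by (rule bounded_linear_compose[OF K_bounded_linear K_bounded_linear])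
  have Y: "bounded_linear Y"
    unfolding Y_def by (rule bounded_linear_add[OF bounded_linear_ident KK])
  have Ysym: "inner (Y x) y = inner x (Y y)" for x y
    by (simp add: Y_def inner_add_left inner_add_right K_skew)
  have Ycontr: "norm (Y x) \<le> norm x" for x
  proof (rule power2_le_imp_le)
    have "inner x (K (K x)) = - (norm (K x))\<^sup>2" using K_skew[of x "K x"] by (simp add: power2_norm_eq_inner)
    then have "(norm (Y x))\<^sup>2 = (norm x)\<^sup>2 - 2 * (norm (K x))\<^sup>2 + (norm (K (K x)))\<^sup>2"
      unfolding Y_def power2_norm_eq_inner by (simp add: inner_add_left inner_add_right inner_commute)
    also have "\<dots> \<le> (norm x)\<^sup>2"
    proof -
      have "(norm (K (K x)))\<^sup>2 \<le> (norm (K x))\<^sup>2" by (rule power_mono[OF K_contraction]) simp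
      moreover have "0 \<le> (norm (K x))\<^sup>2" by simp
      ultimately show ?thesis by linarith
    qed
    finally show "(norm (Y x))\<^sup>2 \<le> (norm x)\<^sup>2" .
  qed simp
  obtain W where W: "bounded_linear W" "\<And>x y. inner (W x) y = inner x (W y)"
    "\<And>x. W (W x) = x - Y x"
    "\<And>X x. bounded_linear X \<Longrightarrow> (\<And>x. X (Y x) = Y (X x)) \<Longrightarrow> X (W x) = W (X x)"
    using contraction_square_root[OF Y Ysym Ycontr] by blast
  have "W (A x) = A (W x)" for x
    using W(4)[OF A_bounded_linear, of x] by (simp add: Y_def A.add KK_commutes_A)
  moreover have "W (i *\<^sub>C x) = i *\<^sub>C W x" for i x
    using W(4)[OF bounded_linear_scaleC, of i x]
    by (simp add: Y_def scaleC_add_right bounded_clinearD(2)[OF K_clinear])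
  ultimately show ?thesis using that[of W] W by (simp add: bounded_clinear_def Y_def)
qed

lemma gap_interval_eq:
  "Delta_c_plus s a1 a2 = {(s + \<bar>a1 - a2\<bar>) / 2<..<(s + a1 + a2) / 2}"
  "Delta_c_minus s a1 a2 = {(s - a1 - a2) / 2<..<(s - \<bar>a1 - a2\<bar>) / 2}"
proof -
  show "Delta_c_plus s a1 a2 = {(s + \<bar>a1 - a2\<bar>) / 2<..<(s + a1 + a2) / 2}"
    unfolding Delta_c_plus_def
  proof (intro subset_antisym subsetI)
    fix t assume "t \<in> {(s + \<bar>a1 - a2\<bar>) / 2<..<(s + a1 + a2) / 2}"
    then show "t \<in> {(s + l) / 2 | l. \<bar>a1 - a2\<bar> < l \<and> l < a1 + a2}"
      by (intro CollectI exI[of _ "2 * t - s"]) auto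
  qed auto
  show "Delta_c_minus s a1 a2 = {(s - a1 - a2) / 2<..<(s - \<bar>a1 - a2\<bar>) / 2}"
    unfolding Delta_c_minus_def
  proof (intro subset_antisym subsetI)
    fix t assume "t \<in> {(s - a1 - a2) / 2<..<(s - \<bar>a1 - a2\<bar>) / 2}"
    then show "t \<in> {(s - l) / 2 | l. \<bar>a1 - a2\<bar> < l \<and> l < a1 + a2}"
      by (intro CollectI exI[of _ "s - 2 * t"]) auto
  qed auto
qed

text \<open>Intervals inside the middle block's range of values that avoid all four zeros of \<open>K\<^sup>2\<close>; both parts of
the continuous spectrum are exhausted by such intervals.\<close>

definition regular_interval :: "real \<Rightarrow> real \<Rightarrow> bool" where
  "regular_interval a b \<longleftrightarrow> a \<le> b \<and> c < a \<and> b < c + a1 + a2 \<and> c + a1 \<notin> {a..b} \<and> c + a2 \<notin> {a..b}"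

lemma regular_intervalI:
  assumes "a \<le> b" "{a..b} \<subseteq> Delta_c_plus s a1 a2 \<or> {a..b} \<subseteq> Delta_c_minus s a1 a2"
  shows "regular_interval a b"
proof -
  have ends: "a \<in> {a..b}" "b \<in> {a..b}" using assms(1) by auto
  show ?thesis
    using assms(2)
  proof
    assume "{a..b} \<subseteq> Delta_c_plus s a1 a2"
    then have "(s + \<bar>a1 - a2\<bar>) / 2 < a" "b < (s + a1 + a2) / 2"
      using ends unfolding gap_interval_eq by auto
    then show ?thesis
      using assms(1) a1 a2 unfolding regular_interval_def s_def by (auto simp: abs_if split: if_splits)
  next
    assume "{a..b} \<subseteq> Delta_c_minus s a1 a2"
    then have "(s - a1 - a2) / 2 < a" "b < (s - \<bar>a1 - a2\<bar>) / 2"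
      using ends unfolding gap_interval_eq by auto
    then show ?thesis
      using assms(1) a1 a2 unfolding regular_interval_def s_def by (auto simp: abs_if split: if_splits)
  qed
qed

end

locale one_parameter_spectral = one_parameter_projections +
  fixes E :: "real set \<Rightarrow> 'a \<Rightarrow> 'a"
  assumes spectral: "spectral_measure_of A E"
begin

sublocale spectral_resolution A E
  by unfold_locales (rule A_bounded_linear A_sym spectral)+

lemma E_linear: "linear (E {a..b})"
  by (simp add: E_bounded_linear bounded_linear.linear)

lemma range_E_middle:
  assumes ab: "regular_interval a b" and x: "E {a..b} x = x"
  shows "x \<in> middle"
proof (rule middle_if_form_between[of "{y. E {a..b} y = y}" a b])
  have "a \<le> b" using ab by (simp add: regular_interval_def)
  then show "y - upper y \<in> {y. E {a..b} y = y}" "lower y \<in> {y. E {a..b} y = y}"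
    if "y \<in> {y. E {a..b} y = y}" for y
    using that commuting_maps_range[OF upper.bounded_linear upper_simps(7)]
      commuting_maps_range[OF lower.bounded_linear lower_simps(7)]
    by (simp_all add: linear_diff[OF E_linear])
  show "a * (norm y)\<^sup>2 \<le> inner y (A y)" "inner y (A y) \<le> b * (norm y)\<^sup>2"
    if "y \<in> {y. E {a..b} y = y}" for y
    using that form_ge[of "{a..b}" a y] form_le[of "{a..b}" b y] by auto
  show "c < a" "b < c + a1 + a2" using ab by (simp_all add: regular_interval_def)
  show "x \<in> {y. E {a..b} y = y}" using x by simp
qed

lemma shift_bounded_below_interval:
  assumes q: "q \<notin> {a..b}" 
  shows "\<exists>\<rho>>0. \<forall>x. E {a..b} x = x \<longrightarrow> \<rho> * norm x \<le> norm (D x - (2 * q - s) *\<^sub>R x)"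
proof -
  have D: "norm (D x - (2 * q - s) *\<^sub>R x) = 2 * norm (A x - q *\<^sub>R x)" for x
  proof -
    have "D x - (2 * q - s) *\<^sub>R x = 2 *\<^sub>R (A x - q *\<^sub>R x)" by (simp add: D_def algebra_simps)
    then show ?thesis by simp
  qed
  define \<rho> where "\<rho> = (if q < a then a - q else q - b)"
  show ?thesis
  proof (cases "a \<le> b")
    case True
    then have "\<rho> > 0" using q by (auto simp: \<rho>_def)
    moreover have "\<rho> * norm x \<le> norm (A x - q *\<^sub>R x)" if "E {a..b} x = x" for x
      by (rule shift_bounded_below[where B = "{a..b}" and b = "if q < a then a else b"])
        (use that in \<open>auto simp: \<rho>_def\<close>)
    ultimately show ?thesis unfolding D by (intro exI[of _ \<rho>]) (smt (verit) norm_ge_zero)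
  next
    case False
    then have "E {a..b} x = 0" for x by simp
    then show ?thesis by (intro exI[of _ 1]) auto
  qed
qed

lemma KK_bounded_below:
  assumes ab: "regular_interval a b"
  shows "\<exists>\<delta>>0. \<forall>x. E {a..b} x = x \<longrightarrow> \<delta> * norm x \<le> norm (K (K x))"
proof -
  let ?V = "{x. E {a..b} x = x}"
  define S where "S w y = D y - w *\<^sub>R y" for w y
  have SV: "S w y \<in> ?V" if "y \<in> ?V" for w y
    using that by (simp add: S_def D_def linear_diff[OF E_linear] linear_scale[OF E_linear] E_commutes_A)
  have low: "\<exists>\<rho>>0. \<forall>x\<in>?V. \<rho> * norm x \<le> norm (S (2 * q - s) x)" if "q \<notin> {a..b}" for q
    using shift_bounded_below_interval[OF that] by (simp add: S_def)
  have w: "2 * (c + a1 + a2) - s = a1 + a2" "2 * c - s = - (a1 + a2)"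
    "2 * (c + a1) - s = a1 - a2" "2 * (c + a2) - s = - (a1 - a2)" by (simp_all add: s_def)
  obtain \<rho>1 where 1: "\<rho>1 > 0" "\<And>x. x \<in> ?V \<Longrightarrow> \<rho>1 * norm x \<le> norm (S (a1 + a2) x)"
    using low[of "c + a1 + a2"] ab unfolding w by (auto simp: regular_interval_def)
  obtain \<rho>2 where 2: "\<rho>2 > 0" "\<And>x. x \<in> ?V \<Longrightarrow> \<rho>2 * norm x \<le> norm (S (- (a1 + a2)) x)"
    using low[of c] ab unfolding w by (auto simp: regular_interval_def)
  obtain \<rho>3 where 3: "\<rho>3 > 0" "\<And>x. x \<in> ?V \<Longrightarrow> \<rho>3 * norm x \<le> norm (S (a1 - a2) x)"
    using low[of "c + a1"] ab unfolding w by (auto simp: regular_interval_def)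
  obtain \<rho>4 where 4: "\<rho>4 > 0" "\<And>x. x \<in> ?V \<Longrightarrow> \<rho>4 * norm x \<le> norm (S (- (a1 - a2)) x)"
    using low[of "c + a2"] ab unfolding w by (auto simp: regular_interval_def)
  define N where "N = 64 * a1\<^sup>2 * a2\<^sup>2"
  have N: "N > 0" using a1 a2 by (simp add: N_def)
  have "\<rho>1 * \<rho>2 * \<rho>3 * \<rho>4 * norm x \<le> N * norm (K (K x))" if x: "x \<in> ?V" for x
  proof -
    define y3 y2 y1 where "y3 = S (- (a1 - a2)) x" and "y2 = S (a1 - a2) y3" and "y1 = S (- (a1 + a2)) y2"
    have yV: "y3 \<in> ?V" "y2 \<in> ?V" "y1 \<in> ?V"
      using x SV by (simp_all only: y3_def y2_def y1_def)
    have "N *\<^sub>R K (K x) = S (a1 + a2) y1"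
      unfolding N_def y1_def y2_def y3_def
      by (rule KK_factorization[OF _ S_def]) (use range_E_middle[OF ab] x in simp)
    then have "N * norm (K (K x)) = norm (S (a1 + a2) y1)" using N by (metis abs_of_pos norm_scaleR)
    moreover have "\<rho>1 * (\<rho>2 * (\<rho>3 * (\<rho>4 * norm x))) \<le> norm (S (a1 + a2) y1)"
    proof -
      have "\<rho>4 * norm x \<le> norm y3" using 4(2)[OF x] by (simp only: y3_def)
      then have "\<rho>3 * (\<rho>4 * norm x) \<le> \<rho>3 * norm y3" using 3(1) by simp
      also have "\<dots> \<le> norm y2" using 3(2)[OF yV(1)] by (simp only: y2_def)
      finally have "\<rho>2 * (\<rho>3 * (\<rho>4 * norm x)) \<le> \<rho>2 * norm y2" using 2(1) by simp
      also have "\<dots> \<le> norm y1" using 2(2)[OF yV(2)] by (simp only: y1_def)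
      finally have "\<rho>1 * (\<rho>2 * (\<rho>3 * (\<rho>4 * norm x))) \<le> \<rho>1 * norm y1" using 1(1) by simp
      also have "\<dots> \<le> norm (S (a1 + a2) y1)" by (rule 1(2)[OF yV(3)])
      finally show ?thesis .
    qed
    ultimately show ?thesis by (simp add: mult.assoc)
  qed
  then have "\<rho>1 * \<rho>2 * \<rho>3 * \<rho>4 / N * norm x \<le> norm (K (K x))" if "x \<in> ?V" for x
    using that N by (simp add: field_simps)
  moreover have "\<rho>1 * \<rho>2 * \<rho>3 * \<rho>4 / N > 0" using 1 2 3 4 N by simp
  ultimately show ?thesis by blast
qed

text \<open>\<open>K\<^sup>2\<close> is symmetric and bounded below on the spectral subspace \<open>V\<close>. Its square, extended by the
identity to the orthogonal complement of \<open>V\<close>, is coercive on the whole space and hence invertible.\<close>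

lemma KK_surjective:
  assumes ab: "regular_interval a b" and x: "E {a..b} x = x"
  shows "\<exists>y. E {a..b} y = y \<and> K (K y) = x"
proof -
  obtain \<delta> where \<delta>: "\<delta> > 0" "\<And>x. E {a..b} x = x \<Longrightarrow> \<delta> * norm x \<le> norm (K (K x))"
    using KK_bounded_below[OF ab] by blast
  let ?F = "E {a..b}"
  have F: "orthogonal_projection ?F" by (simp add: E_projection)
  have FF: "?F (?F y) = ?F y" for y by (simp add: E_Int)
  have KKbl: "bounded_linear (\<lambda>x. K (K x))"
    by (rule bounded_linear_compose[OF K_bounded_linear K_bounded_linear])
  have KKF: "?F (K (K y)) = K (K y)" if "?F y = y" for y
    using commuting_maps_range[OF KKbl KK_commutes_A _ that] ab by (simp add: regular_interval_def)
  define Z where "Z y = K (K (K (K (?F y)))) + (y - ?F y)" for y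
  have Fbl: "bounded_linear ?F" by (simp add: E_bounded_linear)
  have Z: "bounded_linear Z"
    unfolding Z_def
    by (rule bounded_linear_add[OF bounded_linear_compose[OF KKbl bounded_linear_compose[OF KKbl Fbl]]
          bounded_linear_sub[OF bounded_linear_ident Fbl]])
  have coercive: "min (\<delta>\<^sup>2) 1 * (norm y)\<^sup>2 \<le> inner y (Z y)" for y
  proof -
    have "inner y (K (K (K (K (?F y))))) = inner y (?F (K (K (K (K (?F y))))))"
      by (simp add: KKF FF)
    also have "\<dots> = inner (?F y) (K (K (K (K (?F y)))))" by (simp add: E_sym)
    also have "\<dots> = (norm (K (K (?F y))))\<^sup>2"
      using K_skew[of "?F y"] K_skew[of "K (?F y)"] by (simp add: power2_norm_eq_inner)
    also have "\<dots> \<ge> \<delta>\<^sup>2 * (norm (?F y))\<^sup>2"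
      using power_mono[OF \<delta>(2)[OF FF[of y]], of 2] \<delta>(1) by (simp add: power_mult_distrib)
    finally have 1: "\<delta>\<^sup>2 * (norm (?F y))\<^sup>2 \<le> inner y (K (K (K (K (?F y)))))" .
    have 2: "inner y (y - ?F y) = (norm (y - ?F y))\<^sup>2"
      using orthogonal_projection_pythagoras[OF F, of y] by (simp add: inner_diff_right power2_norm_eq_inner)
    have "min (\<delta>\<^sup>2) 1 * (norm y)\<^sup>2
        = min (\<delta>\<^sup>2) 1 * (norm (?F y))\<^sup>2 + min (\<delta>\<^sup>2) 1 * (norm (y - ?F y))\<^sup>2"
      unfolding orthogonal_projection_pythagoras(2)[OF F, of y] by (simp add: distrib_left)
    also have "\<dots> \<le> \<delta>\<^sup>2 * (norm (?F y))\<^sup>2 + 1 * (norm (y - ?F y))\<^sup>2"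
      by (intro add_mono mult_right_mono) auto
    also have "\<dots> \<le> inner y (Z y)" using 1 2 by (simp add: Z_def inner_add_right)
    finally show ?thesis .
  qed
  obtain R where R: "\<And>y. Z (R y) = y"
    using coercive_invertible[OF Z _ coercive] \<delta>(1) by auto
  define u where "u = ?F (R x)"
  have u: "?F u = u" by (simp add: u_def FF)
  have "x = ?F (Z (R x))" using R x by simp
  also have "\<dots> = K (K (K (K u)))"
    using KKF u by (simp add: Z_def linear_add[OF E_linear] linear_diff[OF E_linear] FF flip: u_def)
  finally show ?thesis using KKF[OF u] by metis
qed

text \<open>\<open>W x\<close> and \<open>K x\<close> have the same norm, \<open>W\<close> preserves the upper part and \<open>K\<close> maps it to the lower part.
Both have dense range: on the subspace of a closed subinterval \<open>- K\<^sup>2 = W\<^sup>2\<close> is onto.\<close>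

lemma parts_unitarily_equivalent:
  "unitarily_equivalent_on (range (E (Delta_c_plus s a1 a2))) A
     (range (E (Delta_c_minus s a1 a2))) (\<lambda>x. s *\<^sub>R x - A x)"
proof -
  let ?p = "Delta_c_plus s a1 a2" and ?m = "Delta_c_minus s a1 a2"
  define lo hi where "lo = (s + \<bar>a1 - a2\<bar>) / 2" and "hi = (s + a1 + a2) / 2"
  have p_eq: "?p = {lo<..<hi}" and m_eq: "?m = {s - hi<..<s - lo}"
    unfolding gap_interval_eq lo_def hi_def by (auto simp: field_simps)
  have lohi: "lo < hi" using a1 a2 by (auto simp: lo_def hi_def abs_if)
  have bor: "?p \<in> sets borel" "?m \<in> sets borel" by (simp_all add: p_eq m_eq)
  obtain W where W: "bounded_clinear W" "\<And>x y. inner (W x) y = inner x (W y)"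
    "\<And>x. W (W x) = - K (K x)" "\<And>x. W (A x) = A (W x)"
    using commutator_root by blast
  interpret W: bounded_linear W by (rule bounded_clinearD(1)[OF W(1)])
  let ?V = "{x. E ?p x = x}" and ?V' = "{x. E ?m x = x}"
  have in_p: "E ?p y = y" if "E {a..b} y = y" "lo < a" "b < hi" for a b y
    by (rule E_mono[of "{a..b}"]) (use that in \<open>auto simp: p_eq\<close>)
  have in_m: "E ?m y = y" if "E {a..b} y = y" "s - hi < a" "b < s - lo" for a b y
    by (rule E_mono[of "{a..b}"]) (use that in \<open>auto simp: m_eq\<close>)
  have reg_p: "regular_interval a b" if "lo < a" "a \<le> b" "b < hi" for a b
    using that by (intro regular_intervalI) (auto simp: p_eq)
  have reg_m: "regular_interval a b" if "s - hi < a" "a \<le> b" "b < s - lo" for a b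
    using that by (intro regular_intervalI disjI2) (auto simp: m_eq)
  have linE: "linear (E B)" if "B \<in> sets borel" for B
    using that E_bounded_linear bounded_linear.linear by blast
  have WV: "W x \<in> ?V" if "x \<in> ?V" for x
  proof -
    have "E ?p (W x) = W x"
    proof (rule maps_open_range[OF W.bounded_linear lohi _ bor(1)])
      fix a b y assume "lo < a" "a \<le> b" "b < hi" "E {a..b} y = y"
      then show "E ?p (W y) = W y"
        using commuting_maps_range[OF W.bounded_linear W(4)] in_p by blast
    qed (use that in \<open>simp add: p_eq\<close>)
    then show ?thesis by simp
  qed
  have KV: "K x \<in> ?V'" if "x \<in> ?V" for x
  proof -
    have "E ?m (K x) = K x"
    proof (rule maps_open_range[OF K_bounded_linear lohi _ bor(2)])
      fix a b y assume "lo < a" "a \<le> b" "b < hi" "E {a..b} y = y"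
      then show "E ?m (K y) = K y"
        using reflecting_maps_range[OF K_bounded_linear K_reflects, of a b y]
          in_m[of "s - b" "s - a" "K y"] by simp
    qed (use that in \<open>simp add: p_eq\<close>)
    then show ?thesis by simp
  qed
  have dense_W: "?V \<subseteq> closure (W ` ?V)"
  proof
    fix x assume "x \<in> ?V"
    then have "E {lo<..<hi} x = x" by (simp add: p_eq)
    then obtain \<xi> where \<xi>: "\<xi> \<longlonglongrightarrow> x"
      "\<And>n::nat. \<exists>a b. lo < a \<and> a \<le> b \<and> b < hi \<and> E {a..b} (\<xi> n) = \<xi> n"
      using open_interval_range_approx[OF lohi] by blast
    have "\<xi> n \<in> W ` ?V" for n
    proof -
      obtain a b where ab: "lo < a" "a \<le> b" "b < hi" "E {a..b} (\<xi> n) = \<xi> n" using \<xi>(2) by blast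
      obtain y where y: "E {a..b} y = y" "K (K y) = \<xi> n"
        using KK_surjective[OF reg_p[OF ab(1-3)] ab(4)] by blast
      have "y \<in> ?V" using in_p[OF y(1) ab(1,3)] by simp
      then have "- W y \<in> ?V" using WV[of y] by (simp add: linear_neg[OF linE[OF bor(1)]])
      moreover have "\<xi> n = W (- W y)" using y(2) by (simp add: W.neg W(3))
      ultimately show ?thesis by blast
    qed
    then show "x \<in> closure (W ` ?V)" using \<xi>(1) closure_sequential by blast
  qed
  have dense_K: "?V' \<subseteq> closure (K ` ?V)"
  proof
    fix x assume "x \<in> ?V'"
    then have "E {s - hi<..<s - lo} x = x" by (simp add: m_eq)
    then obtain \<xi> where \<xi>: "\<xi> \<longlonglongrightarrow> x"
      "\<And>n::nat. \<exists>a b. s - hi < a \<and> a \<le> b \<and> b < s - lo \<and> E {a..b} (\<xi> n) = \<xi> n"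
      using open_interval_range_approx[of "s - hi" "s - lo" x] lohi by auto
    have "\<xi> n \<in> K ` ?V" for n
    proof -
      obtain a b where ab: "s - hi < a" "a \<le> b" "b < s - lo" "E {a..b} (\<xi> n) = \<xi> n" using \<xi>(2) by blast
      obtain y where y: "E {a..b} y = y" "K (K y) = \<xi> n"
        using KK_surjective[OF reg_m[OF ab(1-3)] ab(4)] by blast
      have "E {s - b..s - a} (K y) = K y"
        by (rule reflecting_maps_range[OF K_bounded_linear K_reflects ab(2) y(1)])
      then have "K y \<in> ?V" using in_p[of "s - b" "s - a" "K y"] ab by simp
      then have "K (K y) \<in> K ` ?V" by (rule imageI)
      then show ?thesis unfolding y(2) .
    qed
    then show "x \<in> closure (K ` ?V)" using \<xi>(1) closure_sequential by blast
  qed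
  have "unitarily_equivalent_on ?V A ?V' (\<lambda>x. s *\<^sub>R x - A x)"
  proof (rule unitary_equivalence_from_dense_ranges[OF _ _ _ _ W(1) _ dense_W K_clinear _ dense_K])
    show "subspace ?V"
      using linE[OF bor(1)] by (auto simp: subspace_def linear_0 linear_add linear_scale)
    show "closed ?V" "closed ?V'" using bor by (auto intro: closed_range_E)
    show "i *\<^sub>C x \<in> ?V" if "x \<in> ?V" for i x
      using that orthogonal_projectionD(2)[OF E_projection[OF bor(1)]] by simp
    show "W ` ?V \<subseteq> ?V" "K ` ?V \<subseteq> ?V'" using WV KV by blast+
    show "inner (W x) (W y) = inner (K x) (K y)" for x y
      by (simp add: W(2,3) K_skew)
    show "A ` ?V \<subseteq> ?V" using E_commutes_A[OF bor(1)] by auto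
    show "(\<lambda>x. s *\<^sub>R x - A x) ` ?V' \<subseteq> ?V'"
      using E_commutes_A[OF bor(2)] by (auto simp: linear_diff linear_scale linE[OF bor(2)])
    show "bounded_linear (\<lambda>x. s *\<^sub>R x - A x)"
      by (intro bounded_linear_sub bounded_linear_scaleR_right A.bounded_linear)
  qed (use A_bounded_linear W(4) K_reflects in auto)
  then show ?thesis by (simp only: range_E_eq bor)
qed

end

section \<open>Representations of unitarily one-parameter posets\<close>

theorem proposition3:
  fixes S :: "'s::order set"
    and g :: "nat \<Rightarrow> 's" and h\<^sub>1 h\<^sub>2 :: 's
    and m k :: nat
    and P :: "'s \<Rightarrow> 'a::complex_hilbert_space \<Rightarrow> 'a"
    and \<alpha> :: "nat \<Rightarrow> real" and a\<^sub>1 a\<^sub>2 s :: real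
    and A :: "'a \<Rightarrow> 'a"
  assumes "unitarily_one_parameter S"
    and "one_parameter_enumeration S m k g h\<^sub>1 h\<^sub>2"
    and "hilbert_representation S P"
    and "\<And>j. j \<in> {1..m} - {k} \<Longrightarrow> \<alpha> j > 0"
    and "a\<^sub>1 > 0" and "a\<^sub>2 > 0"
    and "A = (\<lambda>x. (\<Sum>j\<in>{1..m} - {k}. \<alpha> j *\<^sub>R P (g j) x) + a\<^sub>1 *\<^sub>R P h\<^sub>1 x + a\<^sub>2 *\<^sub>R P h\<^sub>2 x)"
    and "s = a\<^sub>1 + a\<^sub>2 + 2 * (\<Sum>j=k+1..m. \<alpha> j)"
  shows "spectrum A \<subseteq>
      complex_of_real ` (Delta_d m k \<alpha> a\<^sub>1 a\<^sub>2 \<union> Delta_c_plus s a\<^sub>1 a\<^sub>2 \<union> Delta_c_minus s a\<^sub>1 a\<^sub>2)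
    \<and> (\<forall>E. spectral_measure_of A E \<longrightarrow>
        unitarily_equivalent_on
          (range (E (Delta_c_plus s a\<^sub>1 a\<^sub>2))) A
          (range (E (Delta_c_minus s a\<^sub>1 a\<^sub>2))) (\<lambda>x. s *\<^sub>R x - A x))
    \<and> (\<forall>l. \<bar>a\<^sub>1 - a\<^sub>2\<bar> < l \<and> l < a\<^sub>1 + a\<^sub>2 \<longrightarrow>
        (eigenvalue A (complex_of_real ((s + l) / 2)) \<longleftrightarrow>
         eigenvalue A (complex_of_real ((s - l) / 2))) \<and>
        same_multiplicity A (complex_of_real ((s + l) / 2)) (complex_of_real ((s - l) / 2)))"
proof -
  have k: "1 \<le> k" "k \<le> m"
    and S: "S = g ` ({1..m} - {k}) \<union> {h\<^sub>1, h\<^sub>2}"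
    and below: "\<And>i j. 1 \<le> i \<Longrightarrow> i < j \<Longrightarrow> j < k \<Longrightarrow> g i < g j"
    and pred: "1 < k \<Longrightarrow> g (k - 1) < h\<^sub>1 \<and> g (k - 1) < h\<^sub>2"
    and succ: "k < m \<Longrightarrow> h\<^sub>1 < g (k + 1) \<and> h\<^sub>2 < g (k + 1)"
    and above: "\<And>i j. k < i \<Longrightarrow> i < j \<Longrightarrow> j \<le> m \<Longrightarrow> g i < g j"
    using assms(2) by (auto simp: one_parameter_enumeration_def)
  have proj: "orthogonal_projection (P x)" if "x \<in> S" for x
    using assms(3) that by (simp add: hilbert_representation_def)
  have absorb: "P x (P y v) = P x v" if "x \<in> S" "y \<in> S" "x < y" for x y v
    using assms(3) that unfolding hilbert_representation_def by (metis comp_apply)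
  have low: "g i < h\<^sub>1 \<and> g i < h\<^sub>2" if "1 \<le> i" "i < k" for i
  proof (cases "i = k - 1")
    case False
    then have "g i < g (k - 1)" using that by (intro below) auto
    then show ?thesis using pred that by (auto intro: less_trans)
  qed (use pred that in auto)
  have high: "h\<^sub>1 < g j \<and> h\<^sub>2 < g j" if "k < j" "j \<le> m" for j
  proof (cases "j = k + 1")
    case False
    then have "g (k + 1) < g j" using that by (intro above) auto
    then show ?thesis using succ that by (auto intro: less_trans)
  qed (use succ that in auto)
  have chain: "g i < g j" if ij: "i \<in> {1..m} - {k}" "j \<in> {1..m} - {k}" "i < j" for i j
  proof -
    consider "j < k" | "k < i" | "i < k" "k < j" using ij by fastforce
    then show ?thesis
    proof cases
      case 3
      then show ?thesis using low[of i] high[of j] that by (auto intro: less_trans)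
    qed (use that below above in auto)
  qed
  interpret Q: one_parameter_projections m k "\<lambda>j. P (g j)" "P h\<^sub>1" "P h\<^sub>2" \<alpha> a\<^sub>1 a\<^sub>2
  proof
    show "1 \<le> k" "k \<le> m" "a\<^sub>1 > 0" "a\<^sub>2 > 0" by (fact k assms)+
  qed (use assms(4) S k in \<open>auto intro!: proj absorb chain simp: low high\<close>)
  have A: "A = Q.A" by (simp add: assms(7) Q.A_def[abs_def])
  have s: "s = Q.s" by (simp add: assms(8) Q.s_def Q.c_def)
  have "unitarily_equivalent_on (range (E (Delta_c_plus s a\<^sub>1 a\<^sub>2))) A
      (range (E (Delta_c_minus s a\<^sub>1 a\<^sub>2))) (\<lambda>x. s *\<^sub>R x - A x)" if "spectral_measure_of A E" for E
  proof -
    interpret R: one_parameter_spectral m k "\<lambda>j. P (g j)" "P h\<^sub>1" "P h\<^sub>2" \<alpha> a\<^sub>1 a\<^sub>2 E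
      by unfold_locales (use that A in simp)
    show ?thesis unfolding A s by (rule R.parts_unitarily_equivalent)
  qed
  moreover have "(eigenvalue A (complex_of_real ((s + l) / 2)) \<longleftrightarrow>
         eigenvalue A (complex_of_real ((s - l) / 2))) \<and>
        same_multiplicity A (complex_of_real ((s + l) / 2)) (complex_of_real ((s - l) / 2))"
    if l: "\<bar>a\<^sub>1 - a\<^sub>2\<bar> < l" "l < a\<^sub>1 + a\<^sub>2" for l
  proof -
    have z: "2 * ((s + l) / 2) - s = l" "s - (s + l) / 2 = (s - l) / 2" by (simp_all add: field_simps)
    have "\<bar>l\<bar> = l" using l by simp
    then show ?thesis
      using Q.eigenvectors_reflect[of "(s + l) / 2", folded A s, unfolded z] l by simp
  qed
  ultimately show ?thesis using Q.spectrum_A unfolding A[symmetric] s[symmetric] by blast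
qed

end
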